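(* Let $f:(\mathbb K^n,0)\to(\mathbb K^p,0)$ be a $\mathcal K_e$-finite weighted-homogeneous analytic map-germ with good weights (with respect to the chosen $\bar f^1,\dots,\bar f^m$ below). Then every stable unfolding of $f$ of the form $$F(x,\lambda)=\Big(f(x)+\sum_{k=1}^m\Big(\lambda_k+\sum_{s=1}^m\lambda_s\,q_k^s(f(x),\lambda)\Big)\bar f^k(x),\ \lambda\Big),\qquad q_k^s\in\mathcal O_{p+m},\ q_k^s(X,0)\in\mathfrak m_p,$$ is substantial.
   Context: Let $\mathbb K=\mathbb C$ or $\mathbb R$; all germs analytic. $\mathcal O_s$ is the ring of germs of functions on $(\mathbb K^s,0)$, $\mathfrak m_s$ its maximal ideal, $\theta_s$ the module of germs of vector fields; $\theta(f)\cong\mathcal O_n^p$, with basis $\partial/\partial X_j$. $T\mathcal K_e f=df(\theta_n)+f^*\mathfrak m_p\theta(f)$; $f$ is $\mathcal K_e$-finite if this has finite $\mathbb K$-codimension in $\theta(f)$. A germ $g$ is stable if $dg(\theta_n)+\{\eta\circ g:\eta\in\theta_p\}$ is all of $\theta(g)$. $\bar f^1,\dots,\bar f^m\in\theta(f)$ are chosen so that $T\mathcal K_e f+\mathrm{span}_{\mathbb K}\{\bar f^k\}+\mathrm{span}_{\mathbb K}\{\partial/\partial X_j\}=\theta(f)$ with $m$ minimal, and each $\bar f^k=x^{\alpha_k}\partial/\partial X_{j_k}$ is a single monomial in the single component $j_k$. $f=(f_1,\dots,f_p)$ is weighted-homogeneous if there are positive integers $w_1,\dots,w_n,d_1,\dots,d_p$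 with $f_j(t^{w_1}x_1,\dots,t^{w_n}x_n)=t^{d_j}f_j(x)$ for all $j$ and $t\in\mathbb K$. Then each monomial $x^{\alpha_k}$ has a weighted degree $d_{p+k}=\sum_i w_i(\alpha_k)_i$; $f$ has good weights if $d_{p+k}\neq d_{j_k}$ for all $k=1,\dots,m$. An $m$-parameter unfolding of $f$ is $F(x,\lambda)=(f_\lambda(x),\lambda)$ with $f_0=f$; target coordinates $(X,\Lambda)\in\mathbb K^p\times\mathbb K^m$; $\mathfrak m_\Lambda\subset\mathcal O_{p+m}$ is the ideal generated by $\Lambda_1,\dots,\Lambda_m$. $\eta\in\theta_{p+m}$ is liftable for $F$ if $\eta\circ F=dF(\xi)$ for some $\xi\in\theta_{n+m}$. A stable unfolding $F$ is substantial if there is a liftable $\eta=(\eta_1,\dots,\eta_{p+m})$ with $\eta_{p+k}=\Lambda_k u_k+q_k$, $u_k$ a unit of $\mathcal O_{p+m}$, $q_k\in\mathfrak m_\Lambda\mathfrak m_{p+m}$, for all $k=1,\dots,m$. *)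

theory Defs
  imports "HOL-Analysis.Analysis"
begin

text \<open>Conventions. The field K is a type variable 'k of class real_normed_field and banach
(up to isomorphism these are exactly R and C). A point of K^N is a function nat => 'k, of which
only the coordinates i < N matter. A function germ on (K^N,0) is represented by a function
(nat => 'k) => 'k; a map germ / vector field with P components by (nat => 'k) => (nat => 'k),
of which only components j < P matter.\<close>

definition multi_idx :: "nat \<Rightarrow> (nat \<Rightarrow> nat) set" where
  "multi_idx N = {\<alpha>. \<forall>i\<ge>N. \<alpha> i = 0}"

definition monom :: "nat \<Rightarrow> (nat \<Rightarrow> 'k::comm_ring_1) \<Rightarrow> (nat \<Rightarrow> nat) \<Rightarrow> 'k" where
  "monom N x \<alpha> = (\<Prod>i<N. x i ^ \<alpha> i)"

definition analytic0 :: "nat \<Rightarrow> ((nat \<Rightarrow> 'k::{real_normed_field,banach}) \<Rightarrow> 'k) \<Rightarrow> bool" where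
  "analytic0 N g \<longleftrightarrow> (\<exists>c r. r > 0 \<and>
     (\<forall>x. (\<forall>i<N. norm (x i) < r) \<longrightarrow> ((\<lambda>\<alpha>. c \<alpha> * monom N x \<alpha>) has_sum g x) (multi_idx N)))"

definition germ_eq :: "nat \<Rightarrow> ((nat \<Rightarrow> 'k::real_normed_field) \<Rightarrow> 'k) \<Rightarrow> ((nat \<Rightarrow> 'k) \<Rightarrow> 'k) \<Rightarrow> bool" where
  "germ_eq N g h \<longleftrightarrow> (\<exists>r>0. \<forall>x. (\<forall>i<N. norm (x i) < r) \<longrightarrow> g x = h x)"

text \<open>Vector fields along a map K^N -> K^P (theta(g)); theta_N is vf N N.\<close>
definition vf :: "nat \<Rightarrow> nat \<Rightarrow> ((nat \<Rightarrow> 'k::{real_normed_field,banach}) \<Rightarrow> (nat \<Rightarrow> 'k)) \<Rightarrow> bool" where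
  "vf N P \<xi> \<longleftrightarrow> (\<forall>j<P. analytic0 N (\<lambda>x. \<xi> x j))"

definition vf_eq :: "nat \<Rightarrow> nat \<Rightarrow> ((nat \<Rightarrow> 'k::real_normed_field) \<Rightarrow> (nat \<Rightarrow> 'k))
    \<Rightarrow> ((nat \<Rightarrow> 'k) \<Rightarrow> (nat \<Rightarrow> 'k)) \<Rightarrow> bool" where
  "vf_eq N P \<xi> \<zeta> \<longleftrightarrow> (\<forall>j<P. germ_eq N (\<lambda>x. \<xi> x j) (\<lambda>x. \<zeta> x j))"

definition pderiv :: "((nat \<Rightarrow> 'k::real_normed_field) \<Rightarrow> 'k) \<Rightarrow> nat \<Rightarrow> (nat \<Rightarrow> 'k) \<Rightarrow> 'k" where
  "pderiv g i x = deriv (\<lambda>t. g (x(i := t))) (x i)"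

definition dmap :: "nat \<Rightarrow> ((nat \<Rightarrow> 'k::real_normed_field) \<Rightarrow> (nat \<Rightarrow> 'k))
    \<Rightarrow> ((nat \<Rightarrow> 'k) \<Rightarrow> (nat \<Rightarrow> 'k)) \<Rightarrow> (nat \<Rightarrow> 'k) \<Rightarrow> (nat \<Rightarrow> 'k)" where
  "dmap N g \<eta> x j = (\<Sum>i<N. pderiv (\<lambda>y. g y j) i x * \<eta> x i)"

text \<open>Membership in T K_e f = df(theta_n) + f^* m_p theta(f).\<close>
definition tKe :: "nat \<Rightarrow> nat \<Rightarrow> ((nat \<Rightarrow> 'k::{real_normed_field,banach}) \<Rightarrow> (nat \<Rightarrow> 'k))
    \<Rightarrow> ((nat \<Rightarrow> 'k) \<Rightarrow> (nat \<Rightarrow> 'k)) \<Rightarrow> bool" where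
  "tKe n p f \<xi> \<longleftrightarrow> (\<exists>\<eta> a. vf n n \<eta> \<and> (\<forall>j<p. \<forall>l<p. analytic0 n (a j l)) \<and>
      vf_eq n p \<xi> (\<lambda>x l. dmap n f \<eta> x l + (\<Sum>j<p. a j l x * f x j)))"

definition Ke_finite :: "nat \<Rightarrow> nat \<Rightarrow> ((nat \<Rightarrow> 'k::{real_normed_field,banach}) \<Rightarrow> (nat \<Rightarrow> 'k)) \<Rightarrow> bool" where
  "Ke_finite n p f \<longleftrightarrow> (\<exists>(M::nat) g. (\<forall>k<M. vf n p (g k)) \<and>
     (\<forall>\<xi>. vf n p \<xi> \<longrightarrow> (\<exists>c. tKe n p f (\<lambda>x l. \<xi> x l - (\<Sum>k<M. c k * g k x l)))))"

definition spans :: "nat \<Rightarrow> nat \<Rightarrow> ((nat \<Rightarrow> 'k::{real_normed_field,banach}) \<Rightarrow> (nat \<Rightarrow> 'k))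
    \<Rightarrow> nat \<Rightarrow> (nat \<Rightarrow> (nat \<Rightarrow> 'k) \<Rightarrow> (nat \<Rightarrow> 'k)) \<Rightarrow> bool" where
  "spans n p f M g \<longleftrightarrow> (\<forall>\<xi>. vf n p \<xi> \<longrightarrow>
     (\<exists>c d. tKe n p f (\<lambda>x l. \<xi> x l - (\<Sum>k<M. c k * g k x l) - d l)))"

definition fbar :: "nat \<Rightarrow> (nat \<Rightarrow> nat \<Rightarrow> nat) \<Rightarrow> (nat \<Rightarrow> nat) \<Rightarrow> nat \<Rightarrow> (nat \<Rightarrow> 'k::comm_ring_1) \<Rightarrow> (nat \<Rightarrow> 'k)" where
  "fbar n \<alpha> jk k x l = (if l = jk k then monom n x (\<alpha> k) else 0)"

definition takep :: "nat \<Rightarrow> (nat \<Rightarrow> 'k::zero) \<Rightarrow> (nat \<Rightarrow> 'k)" where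
  "takep n y = (\<lambda>i. if i < n then y i else 0)"

definition dropp :: "nat \<Rightarrow> (nat \<Rightarrow> 'k) \<Rightarrow> (nat \<Rightarrow> 'k)" where
  "dropp n y = (\<lambda>i. y (i + n))"

definition join :: "nat \<Rightarrow> (nat \<Rightarrow> 'k) \<Rightarrow> (nat \<Rightarrow> 'k) \<Rightarrow> (nat \<Rightarrow> 'k)" where
  "join p X L = (\<lambda>i. if i < p then X i else L (i - p))"

definition unf :: "nat \<Rightarrow> nat \<Rightarrow> nat \<Rightarrow> ((nat \<Rightarrow> 'k::comm_ring_1) \<Rightarrow> (nat \<Rightarrow> 'k))
    \<Rightarrow> (nat \<Rightarrow> nat \<Rightarrow> nat) \<Rightarrow> (nat \<Rightarrow> nat) \<Rightarrow> (nat \<Rightarrow> nat \<Rightarrow> (nat \<Rightarrow> 'k) \<Rightarrow> 'k)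
    \<Rightarrow> (nat \<Rightarrow> 'k) \<Rightarrow> (nat \<Rightarrow> 'k)" where
  "unf n p m f \<alpha> jk q y = (\<lambda>j. if j < p then
      f (takep n y) j + (\<Sum>k<m. (dropp n y k +
          (\<Sum>s<m. dropp n y s * q k s (join p (f (takep n y)) (dropp n y))))
          * fbar n \<alpha> jk k (takep n y) j)
    else dropp n y (j - p))"

definition stable :: "nat \<Rightarrow> nat \<Rightarrow> ((nat \<Rightarrow> 'k::{real_normed_field,banach}) \<Rightarrow> (nat \<Rightarrow> 'k)) \<Rightarrow> bool" where
  "stable N P g \<longleftrightarrow> (\<forall>\<xi>. vf N P \<xi> \<longrightarrow> (\<exists>\<eta> \<zeta>. vf N N \<eta> \<and> vf P P \<zeta> \<and>
      vf_eq N P \<xi> (\<lambda>y j. dmap N g \<eta> y j + \<zeta> (g y) j)))"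

definition liftable :: "nat \<Rightarrow> nat \<Rightarrow> ((nat \<Rightarrow> 'k::{real_normed_field,banach}) \<Rightarrow> (nat \<Rightarrow> 'k))
    \<Rightarrow> ((nat \<Rightarrow> 'k) \<Rightarrow> (nat \<Rightarrow> 'k)) \<Rightarrow> bool" where
  "liftable N P g \<eta> \<longleftrightarrow> (\<exists>\<xi>. vf N N \<xi> \<and> vf_eq N P (\<lambda>y. \<eta> (g y)) (dmap N g \<xi>))"

text \<open>A stable m-parameter unfolding F : (K^(n+m),0) -> (K^(p+m),0) of f : (K^n,0) -> (K^p,0) is substantial:
there is a liftable eta with eta_(p+k) = Lambda_k u_k + q_k, u_k a unit, q_k in m_Lambda m_(p+m)
(the latter written out as q_k = sum_s Lambda_s b_(k,s) with b_(k,s) in m_(p+m)).\<close>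
definition substantial :: "nat \<Rightarrow> nat \<Rightarrow> nat \<Rightarrow> ((nat \<Rightarrow> 'k::{real_normed_field,banach}) \<Rightarrow> (nat \<Rightarrow> 'k)) \<Rightarrow> bool" where
  "substantial n p m F \<longleftrightarrow> stable (n + m) (p + m) F \<and>
    (\<exists>\<eta> u b. vf (p + m) (p + m) \<eta> \<and> liftable (n + m) (p + m) F \<eta> \<and>
      (\<forall>k<m. analytic0 (p + m) (u k) \<and> u k (\<lambda>_. 0) \<noteq> 0 \<and>
         (\<forall>s<m. analytic0 (p + m) (b k s) \<and> b k s (\<lambda>_. 0) = 0) \<and>
         germ_eq (p + m) (\<lambda>Y. \<eta> Y (p + k))
           (\<lambda>Y. Y (p + k) * u k Y + (\<Sum>s<m. Y (p + s) * b k s Y))))"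

definition wh_good_weights :: "nat \<Rightarrow> nat \<Rightarrow> nat \<Rightarrow> ((nat \<Rightarrow> 'k::real_normed_field) \<Rightarrow> (nat \<Rightarrow> 'k))
    \<Rightarrow> (nat \<Rightarrow> nat \<Rightarrow> nat) \<Rightarrow> (nat \<Rightarrow> nat) \<Rightarrow> bool" where
  "wh_good_weights n p m f \<alpha> jk \<longleftrightarrow> (\<exists>w d. (\<forall>i<n. w i > (0::nat)) \<and> (\<forall>j<p. d j > (0::nat)) \<and>
     (\<exists>r>0. \<forall>x. (\<forall>i<n. norm (x i) < r) \<longrightarrow> (\<forall>t::'k. norm t \<le> 1 \<longrightarrow>
        (\<forall>j<p. f (\<lambda>i. t ^ w i * x i) j = t ^ d j * f x j))) \<and>
     (\<forall>k<m. (\<Sum>i<n. w i * \<alpha> k i) \<noteq> d (jk k)))"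

end

theory Submission
  imports Defs
begin

text \<open>Give \<open>x\<^sub>i\<close> the weight \<open>w\<^sub>i\<close> and \<open>\<lambda>\<^sub>k\<close> the weight \<open>c\<^sub>k = d\<^bsub>j\<^sub>k\<^esub> - d\<^bsub>p+k\<^esub>\<close>, nonzero since the weights are good.
  For the corresponding Euler field \<open>e\<close>, the difference between \<open>dF(e)\<close> and
  \<open>(d\<^sub>j X\<^sub>j, c\<^sub>k \<Lambda>\<^sub>k) \<circ> F\<close> is \<open>\<Sum>\<^sub>k \<Sum>\<^sub>s \<lambda>\<^sub>s r\<^sub>k\<^sub>s(f(x), \<lambda>) fbar\<^sup>k\<close> with \<open>r\<^sub>k\<^sub>s\<close> vanishing at \<open>0\<close>.
  Since \<open>f\<^sub>i\<close> and \<open>\<lambda>\<^sub>k\<close> lie in the ideal generated by the components of \<open>F\<close>, this error has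
  coefficients in \<open>F\<^sup>*(m\<^sub>\<Lambda> m\<^bsub>p+m\<^esub>)\<close>. Stability of \<open>F\<close> therefore absorbs it into a lift, changing the
  target field only by terms of \<open>m\<^sub>\<Lambda> m\<^bsub>p+m\<^esub>\<close>.\<close>

section \<open>Power series with absolutely summable coefficients\<close>

text \<open>The obstacle is that the error is a function of \<open>(f(x), \<lambda>)\<close> and not
  of \<open>F(x, \<lambda>)\<close>: it need not be pulled back from the target by \<open>F\<close>,
  so it cannot simply be moved into the target field. It is therefore only expanded over products of
  components of \<open>F\<close>, with arbitrary analytic functions on the source as coefficients,
  and stability is applied to these coefficients times \<open>fbar\<close>. One factor
  \<open>\<Lambda>_s\<close> and one factor \<open>Y_i\<close> stay outside as functions on the
  target. Whatever target field stability returns is thus multiplied by an element of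
  \<open>m_\<Lambda> m_(p+m)\<close>, the linear part \<open>c_k \<Lambda>_k\<close> survives, and
  the constant \<open>c_k\<close> can serve as the unit. The parameter weights \<open>c_k\<close>
  can be negative, so no scaling action on the parameters is used: everything is compared
  infinitesimally, as derivatives along the Euler field. Real and complex scalars are treated at
  once, so the analysis rests on power series and difference quotients alone.\<close>

lemma monom_0 [simp]: "monom 0 x \<alpha> = 1"
  by (simp add: monom_def)

lemma monom_Suc: "monom (Suc N) x \<alpha> = monom N x \<alpha> * x N ^ \<alpha> N"
  by (simp add: monom_def)

lemma monom_zero_idx [simp]: "monom N x (\<lambda>_. 0) = 1"
  by (simp add: monom_def)

lemma monom_add: "monom N x (\<lambda>i. \<alpha> i + \<beta> i) = monom N x \<alpha> * monom N x \<beta>"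
  by (simp add: monom_def power_add prod.distrib)

lemma monom_single: "i < N \<Longrightarrow> monom N x (\<lambda>j. if j = i then 1 else 0) = x i"
proof -
  assume "i < N"
  have "monom N x (\<lambda>j. if j = i then 1 else 0) = (\<Prod>j<N. if j = i then x j else 1)"
    unfolding monom_def by (intro prod.cong) auto
  with \<open>i < N\<close> show ?thesis by simp
qed

lemma monom_cong: "(\<And>i. i < N \<Longrightarrow> x i = y i) \<Longrightarrow> monom N x \<alpha> = monom N y \<alpha>"
  by (simp add: monom_def)

lemma monom_mult: "monom N (\<lambda>i. x i * y i) \<alpha> = monom N x \<alpha> * monom N y \<alpha>"
  by (simp add: monom_def power_mult_distrib prod.distrib)

lemma monom_eq_0:
  "i < N \<Longrightarrow> x i = 0 \<Longrightarrow> \<alpha> i \<noteq> 0 \<Longrightarrow> monom N x \<alpha> = (0::'a::comm_ring_1)"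
  unfolding monom_def by (rule prod_zero) (auto simp: power_0_left intro!: bexI[of _ i])

lemma norm_monom:
  "norm (monom N x \<alpha>) = monom N (\<lambda>i. norm (x i)) \<alpha>" for x :: "nat \<Rightarrow> 'k::real_normed_field"
  by (simp add: monom_def prod_norm[symmetric] norm_power)

lemma monom_mono:
  "(\<And>i. i < N \<Longrightarrow> 0 \<le> x i \<and> x i \<le> y i) \<Longrightarrow> monom N x \<alpha> \<le> monom N y \<alpha>"
  for x :: "nat \<Rightarrow> real"
  unfolding monom_def by (intro prod_mono) (auto intro: power_mono)

lemma monom_pos: "(\<And>i. i < N \<Longrightarrow> 0 < x i) \<Longrightarrow> 0 < monom N x \<alpha>" for x :: "nat \<Rightarrow> real"
  unfolding monom_def by (intro prod_pos) auto

lemma norm_monom_le: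
  fixes x :: "nat \<Rightarrow> 'k::real_normed_field"
  assumes "\<forall>i<N. norm (x i) \<le> \<rho>"
  shows "norm (monom N x \<alpha>) \<le> monom N (\<lambda>_. \<rho>) \<alpha>"
  unfolding norm_monom by (rule monom_mono) (use assms in auto)

lemma zero_multi_idx [simp]: "(\<lambda>_. 0) \<in> multi_idx N"
  by (simp add: multi_idx_def)

lemma single_multi_idx: "i < N \<Longrightarrow> (\<lambda>j. if j = i then k else 0) \<in> multi_idx N"
  by (auto simp: multi_idx_def)

text \<open>Splitting off the last exponent turns the sum into an iterated one whose inner sum is a
  geometric series. This is the comparison series for \<open>analytic0_imp_maj\<close>.\<close>

lemma summable_monom_geometric:
  fixes \<theta> :: real
  assumes \<theta>: "0 < \<theta>" "\<theta> < 1"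
  shows "(\<lambda>\<alpha>. monom N (\<lambda>_. \<theta>) \<alpha>) summable_on multi_idx N"
proof (induction N)
  case 0
  have "multi_idx 0 = {\<lambda>_. 0}"
    by (auto simp: multi_idx_def)
  then show ?case by simp
next
  case (Suc N)
  have geo: "((\<lambda>k. \<theta> ^ k) has_sum (1 / (1 - \<theta>))) UNIV"
    using geometric_sums[of \<theta>] \<theta>
    by (intro norm_summable_imp_has_sum) (auto simp: summable_geometric)
  have "(\<lambda>(\<alpha>, k). monom N (\<lambda>_. \<theta>) \<alpha> * \<theta> ^ k) summable_on (multi_idx N \<times> UNIV)"
  proof (rule summable_on_SigmaI)
    show "((\<lambda>k. case (\<alpha>, k) of (\<alpha>, k) \<Rightarrow> monom N (\<lambda>_. \<theta>) \<alpha> * \<theta> ^ k) has_sum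
        (monom N (\<lambda>_. \<theta>) \<alpha> * (1 / (1 - \<theta>)))) UNIV" for \<alpha>
      using has_sum_cmult_right[OF geo] by simp
    show "(\<lambda>\<alpha>. monom N (\<lambda>_. \<theta>) \<alpha> * (1 / (1 - \<theta>))) summable_on multi_idx N"
      by (rule summable_on_cmult_left[OF Suc.IH])
    show "0 \<le> (case (\<alpha>, k) of (\<alpha>, k) \<Rightarrow> monom N (\<lambda>_. \<theta>) \<alpha> * \<theta> ^ k)" for \<alpha> k
      using \<theta> monom_pos[of N "\<lambda>_. \<theta>" \<alpha>] by simp
  qed
  also have "?this \<longleftrightarrow> ?case"
  proof (rule summable_on_reindex_bij_witness
      [where i = "\<lambda>\<alpha>. (\<alpha>(N := 0), \<alpha> N)" and j = "\<lambda>(\<alpha>, k). \<alpha>(N := k)"], goal_cases)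
    case (5 a)
    obtain \<alpha> k where a: "a = (\<alpha>, k)" by fastforce
    have "monom N (\<lambda>_. \<theta>) (\<alpha>(N := k)) = monom N (\<lambda>_. \<theta>) \<alpha>"
      by (simp add: monom_def)
    then show ?case by (simp add: a monom_Suc fun_upd_def)
  qed (auto simp: multi_idx_def fun_eq_iff)
  finally show ?case .
qed

text \<open>\<open>maj N \<rho> B g\<close>: on the closed polydisc of radius \<open>\<rho>\<close> the function \<open>g\<close> is given by a power
  series whose weighted \<open>\<ell>\<^sup>1\<close> norm at radius \<open>\<rho>\<close> is at most \<open>B\<close>. These norms are submultiplicative,
  so closure under products and compositions reduces to closure under absolutely convergent sums.\<close>

definition maj :: "nat \<Rightarrow> real \<Rightarrow> real \<Rightarrow> ((nat \<Rightarrow> 'k::{real_normed_field,banach}) \<Rightarrow> 'k) \<Rightarrow> bool" where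
  "maj N \<rho> B g \<longleftrightarrow> (\<exists>c S. ((\<lambda>\<alpha>. norm (c \<alpha>) * monom N (\<lambda>_. \<rho>) \<alpha>) has_sum S) (multi_idx N) \<and> S \<le> B \<and>
     (\<forall>x. (\<forall>i<N. norm (x i) \<le> \<rho>) \<longrightarrow> ((\<lambda>\<alpha>. c \<alpha> * monom N x \<alpha>) has_sum g x) (multi_idx N)))"

lemma has_sum_le_of_comparison:
  fixes f g :: "'a \<Rightarrow> real"
  assumes g: "(g has_sum S) A" and le: "\<And>x. x \<in> A \<Longrightarrow> 0 \<le> f x \<and> f x \<le> g x" and "S \<le> B"
  shows "\<exists>S'. (f has_sum S') A \<and> S' \<le> B"
proof -
  have "f summable_on A"
    by (rule summable_on_comparison_test[where f = g]) (use g le in \<open>auto simp: summable_on_def\<close>)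
  then have f: "(f has_sum infsum f A) A"
    by (rule has_sum_infsum)
  have "infsum f A \<le> S"
    using has_sum_mono[OF f g] le by blast
  with f \<open>S \<le> B\<close> show ?thesis
    by (intro exI[of _ "infsum f A"]) auto
qed

lemma maj_mono:
  assumes "maj N \<rho> B g" "0 < \<rho>'" "\<rho>' \<le> \<rho>" "B \<le> B'"
  shows "maj N \<rho>' B' g"
proof -
  from assms(1) obtain c S where
    S: "((\<lambda>\<alpha>. norm (c \<alpha>) * monom N (\<lambda>_. \<rho>) \<alpha>) has_sum S) (multi_idx N)" "S \<le> B" and
    g: "\<And>x. (\<forall>i<N. norm (x i) \<le> \<rho>) \<Longrightarrow> ((\<lambda>\<alpha>. c \<alpha> * monom N x \<alpha>) has_sum g x) (multi_idx N)"
    unfolding maj_def by blast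
  have "\<exists>S'. ((\<lambda>\<alpha>. norm (c \<alpha>) * monom N (\<lambda>_. \<rho>') \<alpha>) has_sum S') (multi_idx N) \<and> S' \<le> B'"
  proof (rule has_sum_le_of_comparison[OF S(1)])
    show "0 \<le> norm (c \<alpha>) * monom N (\<lambda>_. \<rho>') \<alpha> \<and>
        norm (c \<alpha>) * monom N (\<lambda>_. \<rho>') \<alpha> \<le> norm (c \<alpha>) * monom N (\<lambda>_. \<rho>) \<alpha>" for \<alpha>
      using assms less_imp_le[OF monom_pos[of N "\<lambda>_. \<rho>'" \<alpha>]]
      by (auto intro!: mult_left_mono monom_mono)
  qed (use S assms in auto)
  moreover have "((\<lambda>\<alpha>. c \<alpha> * monom N x \<alpha>) has_sum g x) (multi_idx N)" if "\<forall>i<N. norm (x i) \<le> \<rho>'" for x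
    using that assms by (intro g) force
  ultimately show ?thesis unfolding maj_def by blast
qed

lemma maj_abs_summable:
  fixes c :: "(nat \<Rightarrow> nat) \<Rightarrow> 'k::{real_normed_field,banach}"
  assumes "((\<lambda>\<alpha>. norm (c \<alpha>) * monom N (\<lambda>_. \<rho>) \<alpha>) has_sum S) (multi_idx N)"
    and "\<forall>i<N. norm (x i) \<le> \<rho>"
  shows "(\<lambda>\<alpha>. norm (c \<alpha> * monom N x \<alpha>)) summable_on multi_idx N"
  by (rule summable_on_comparison_test[where f = "\<lambda>\<alpha>. norm (c \<alpha>) * monom N (\<lambda>_. \<rho>) \<alpha>"])
     (use assms norm_monom_le[OF assms(2)] in \<open>auto simp: summable_on_def norm_mult intro: mult_left_mono\<close>)

lemma maj_bound:
  assumes "maj N \<rho> B g" "\<forall>i<N. norm (x i) \<le> \<rho>"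
  shows "norm (g x) \<le> B"
proof -
  from assms(1) obtain c S where
    S: "((\<lambda>\<alpha>. norm (c \<alpha>) * monom N (\<lambda>_. \<rho>) \<alpha>) has_sum S) (multi_idx N)" "S \<le> B" and
    g: "\<And>x. (\<forall>i<N. norm (x i) \<le> \<rho>) \<Longrightarrow> ((\<lambda>\<alpha>. c \<alpha> * monom N x \<alpha>) has_sum g x) (multi_idx N)"
    unfolding maj_def by blast
  have "norm (g x) \<le> S"
    by (rule norm_infsum_le[OF g[OF assms(2)] S(1)])
      (auto simp: norm_mult intro!: mult_left_mono norm_monom_le assms(2))
  with S show ?thesis by simp
qed

text \<open>Fubini on \<open>K \<times> M\<close>, once for the weighted norms of the coefficients
  and once for the values at a point: a sum of power series that converges in the weighted norm can
  be collected by monomials. Sums, products and substitutions below are all instances.\<close>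

lemma maj_has_sum:
  fixes g :: "'i \<Rightarrow> (nat \<Rightarrow> 'k::{real_normed_field,banach}) \<Rightarrow> 'k"
  assumes \<rho>: "0 < \<rho>"
    and maj: "\<And>k. k \<in> K \<Longrightarrow> maj N \<rho> (B k) (g k)"
    and B: "(B has_sum T) K"
    and h: "\<And>x. (\<forall>i<N. norm (x i) \<le> \<rho>) \<Longrightarrow> ((\<lambda>k. g k x) has_sum h x) K"
  shows "maj N \<rho> T h"
proof -
  define M where "M = multi_idx N"
  define w where "w = monom N (\<lambda>_. \<rho>)"
  have w: "w \<alpha> > 0" for \<alpha>
    unfolding w_def using \<rho> by (intro monom_pos)
  have "\<forall>k\<in>K. \<exists>cS. ((\<lambda>\<alpha>. norm (fst cS \<alpha>) * w \<alpha>) has_sum snd cS) M \<and> snd cS \<le> B k \<and>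
     (\<forall>x. (\<forall>i<N. norm (x i) \<le> \<rho>) \<longrightarrow> ((\<lambda>\<alpha>. fst cS \<alpha> * monom N x \<alpha>) has_sum g k x) M)"
    using maj unfolding maj_def w_def M_def by simp
  from bchoice[OF this] obtain cS where cS: "\<forall>k\<in>K. ((\<lambda>\<alpha>. norm (fst (cS k) \<alpha>) * w \<alpha>) has_sum snd (cS k)) M \<and> snd (cS k) \<le> B k \<and>
     (\<forall>x. (\<forall>i<N. norm (x i) \<le> \<rho>) \<longrightarrow> ((\<lambda>\<alpha>. fst (cS k) \<alpha> * monom N x \<alpha>) has_sum g k x) M)" ..
  define c S where "c k = fst (cS k)" and "S k = snd (cS k)" for k
  have
    S: "k \<in> K \<Longrightarrow> ((\<lambda>\<alpha>. norm (c k \<alpha>) * w \<alpha>) has_sum S k) M" "k \<in> K \<Longrightarrow> S k \<le> B k" and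
    g: "k \<in> K \<Longrightarrow> (\<forall>i<N. norm (x i) \<le> \<rho>) \<Longrightarrow> ((\<lambda>\<alpha>. c k \<alpha> * monom N x \<alpha>) has_sum g k x) M" for k x
    using cS by (auto simp: c_def S_def)
  have S0: "0 \<le> S k" if "k \<in> K" for k
    by (rule has_sum_nonneg[OF S(1)[OF that]]) (simp add: less_imp_le[OF w])
  obtain T' where T': "(S has_sum T') K" "T' \<le> T"
    using has_sum_le_of_comparison[OF B, of S T] S(2) S0 by blast
  have sumKM: "(\<lambda>(k, \<alpha>). norm (c k \<alpha>) * w \<alpha>) summable_on K \<times> M"
    by (rule summable_on_SigmaI[where g = S])
      (use S(1) T'(1) less_imp_le[OF w] in \<open>auto simp: summable_on_def\<close>)
  then have hsKM: "((\<lambda>(k, \<alpha>). norm (c k \<alpha>) * w \<alpha>) has_sum T') (K \<times> M)"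
    by (intro has_sum_SigmaI[OF _ T'(1)]) (use S(1) in auto)
  then have hsMK: "((\<lambda>(\<alpha>, k). norm (c k \<alpha>) * w \<alpha>) has_sum T') (M \<times> K)"
    using has_sum_swap by fastforce
  have colw: "(\<lambda>k. norm (c k \<alpha>) * w \<alpha>) summable_on K" if "\<alpha> \<in> M" for \<alpha>
    using summable_on_SigmaD1[where f = "\<lambda>\<alpha> k. norm (c k \<alpha>) * w \<alpha>" and B = "\<lambda>_. K", OF _ that] hsMK
    by (auto simp: summable_on_def)
  then have coln: "(\<lambda>k. norm (c k \<alpha>)) summable_on K" if "\<alpha> \<in> M" for \<alpha>
    using summable_on_cmult_left'[of "w \<alpha>" "\<lambda>k. norm (c k \<alpha>)" K] w[of \<alpha>] that by auto
  \<comment> \<open>The coefficients of the total series. Each column is absolutely summable because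
    the positive weight \<open>w \<alpha>\<close> can be divided out of the summable weighted
    column.\<close>
  define C where "C \<alpha> = (\<Sum>\<^sub>\<infinity>k\<in>K. c k \<alpha>)" for \<alpha>
  have C: "((\<lambda>k. c k \<alpha>) has_sum C \<alpha>) K" if "\<alpha> \<in> M" for \<alpha>
    unfolding C_def by (rule has_sum_infsum, rule abs_summable_summable, rule coln[OF that])
  have nC: "norm (C \<alpha>) \<le> (\<Sum>\<^sub>\<infinity>k\<in>K. norm (c k \<alpha>))" if "\<alpha> \<in> M" for \<alpha>
    unfolding C_def by (rule norm_infsum_bound) (rule coln[OF that])
  have cols: "((\<lambda>\<alpha>. \<Sum>\<^sub>\<infinity>k\<in>K. norm (c k \<alpha>) * w \<alpha>) has_sum T') M"
    by (rule has_sum_SigmaD[OF hsMK]) (use has_sum_infsum[OF colw] in auto)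
  have "\<exists>S'. ((\<lambda>\<alpha>. norm (C \<alpha>) * w \<alpha>) has_sum S') M \<and> S' \<le> T"
  proof (rule has_sum_le_of_comparison[OF cols])
    show "0 \<le> norm (C \<alpha>) * w \<alpha> \<and> norm (C \<alpha>) * w \<alpha> \<le> (\<Sum>\<^sub>\<infinity>k\<in>K. norm (c k \<alpha>) * w \<alpha>)" if "\<alpha> \<in> M" for \<alpha>
      using nC[OF that] less_imp_le[OF w[of \<alpha>]]
      by (subst infsum_cmult_left[OF coln[OF that]]) (auto intro: mult_right_mono)
  qed (rule T')
  moreover have "((\<lambda>\<alpha>. C \<alpha> * monom N x \<alpha>) has_sum h x) M" if x: "\<forall>i<N. norm (x i) \<le> \<rho>" for x
  proof -
    have "(\<lambda>(k, \<alpha>). c k \<alpha> * monom N x \<alpha>) summable_on K \<times> M"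
    proof (rule abs_summable_summable, rule summable_on_comparison_test[OF sumKM])
      show "norm (case a of (k, \<alpha>) \<Rightarrow> c k \<alpha> * monom N x \<alpha>) \<le> (case a of (k, \<alpha>) \<Rightarrow> norm (c k \<alpha>) * w \<alpha>)" for a
        using norm_monom_le[OF x] by (auto simp: norm_mult w_def split: prod.split intro!: mult_left_mono)
    qed auto
    then have s: "((\<lambda>(k, \<alpha>). c k \<alpha> * monom N x \<alpha>) has_sum h x) (K \<times> M)"
      by (intro has_sum_SigmaI[OF _ h[OF x]]) (use g[OF _ x] in auto)
    then have s': "((\<lambda>(\<alpha>, k). c k \<alpha> * monom N x \<alpha>) has_sum h x) (M \<times> K)"
      using has_sum_swap by fastforce
    show ?thesis
      by (rule has_sum_SigmaD[OF s']) (use has_sum_cmult_left[OF C] in auto)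
  qed
  ultimately show ?thesis
    unfolding maj_def w_def M_def by blast
qed

lemma has_sum_supported:
  fixes f :: "'a \<Rightarrow> 'b::{t2_space,topological_comm_monoid_add}"
  assumes "a \<in> A" "\<And>x. x \<in> A \<Longrightarrow> x \<noteq> a \<Longrightarrow> f x = 0"
  shows "(f has_sum f a) A"
proof -
  have "(f has_sum f a) {a}"
    by (simp add: has_sum_finite_iff)
  also have "?this \<longleftrightarrow> ?thesis"
    by (rule has_sum_cong_neutral) (use assms in auto)
  finally show ?thesis .
qed

section \<open>Closure of majorised power series under algebraic operations and substitution\<close>

lemma maj_const:
  assumes "0 < \<rho>"
  shows "maj N \<rho> (norm a) (\<lambda>_. a)"
proof -
  define c where "c = (\<lambda>\<alpha>::nat\<Rightarrow>nat. if \<alpha> = (\<lambda>_. 0) then a else 0)"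
  have "((\<lambda>\<alpha>. norm (c \<alpha>) * monom N (\<lambda>_. \<rho>) \<alpha>) has_sum norm a) (multi_idx N)"
    using has_sum_supported[of "\<lambda>_. 0" "multi_idx N" "\<lambda>\<alpha>. norm (c \<alpha>) * monom N (\<lambda>_. \<rho>) \<alpha>"]
    by (simp add: c_def)
  moreover have "((\<lambda>\<alpha>. c \<alpha> * monom N x \<alpha>) has_sum a) (multi_idx N)" for x
    using has_sum_supported[of "\<lambda>_. 0" "multi_idx N" "\<lambda>\<alpha>. c \<alpha> * monom N x \<alpha>"]
    by (simp add: c_def)
  ultimately show ?thesis unfolding maj_def by blast
qed

text \<open>Adding \<open>\<beta>\<close> is a bijection from all exponents onto those dominating
  \<open>\<beta>\<close>. It serves multiplication by a monomial and, read backwards, division by a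
  coordinate.\<close>

lemma has_sum_shift_idx:
  fixes F :: "(nat \<Rightarrow> nat) \<Rightarrow> 'b::{t2_space,topological_comm_monoid_add}"
  assumes "\<beta> \<in> multi_idx N"
  shows "((\<lambda>\<alpha>. F (\<lambda>i. \<alpha> i + \<beta> i)) has_sum s) (multi_idx N) \<longleftrightarrow>
    (F has_sum s) {\<alpha> \<in> multi_idx N. \<forall>i. \<beta> i \<le> \<alpha> i}"
  by (rule has_sum_reindex_bij_witness
      [where i = "\<lambda>\<alpha> i. \<alpha> i - \<beta> i" and j = "\<lambda>\<alpha> i. \<alpha> i + \<beta> i"])
    (use assms in \<open>auto simp: multi_idx_def fun_eq_iff\<close>)

lemma maj_monom_mult:
  assumes "maj N \<rho> B g" "0 < \<rho>" and \<beta>: "\<beta> \<in> multi_idx N"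
  shows "maj N \<rho> (norm a * monom N (\<lambda>_. \<rho>) \<beta> * B) (\<lambda>x. a * monom N x \<beta> * g x)"
proof -
  from assms(1) obtain c S where
    S: "((\<lambda>\<alpha>. norm (c \<alpha>) * monom N (\<lambda>_. \<rho>) \<alpha>) has_sum S) (multi_idx N)" "S \<le> B" and
    g: "\<And>x. (\<forall>i<N. norm (x i) \<le> \<rho>) \<Longrightarrow> ((\<lambda>\<alpha>. c \<alpha> * monom N x \<alpha>) has_sum g x) (multi_idx N)"
    unfolding maj_def by blast
  define c' where "c' \<alpha> = (if \<forall>i. \<beta> i \<le> \<alpha> i then a * c (\<lambda>i. \<alpha> i - \<beta> i) else 0)" for \<alpha>
  have c': "c' (\<lambda>i. \<alpha> i + \<beta> i) = a * c \<alpha>" for \<alpha>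
    by (simp add: c'_def)
  \<comment> \<open>The second premise says that \<open>F\<close> is supported where
    \<open>c'\<close> is nonzero, hence on exponents dominating \<open>\<beta>\<close>, so the
    remaining exponents contribute nothing.\<close>
  have shift: "(F has_sum s) (multi_idx N)"
    if "((\<lambda>\<alpha>. F (\<lambda>i. \<alpha> i + \<beta> i)) has_sum s) (multi_idx N)" "\<And>\<alpha>. c' \<alpha> = 0 \<Longrightarrow> F \<alpha> = 0"
    for F :: "(nat \<Rightarrow> nat) \<Rightarrow> 'c::{t2_space,topological_comm_monoid_add}" and s
  proof -
    from that(1) have "(F has_sum s) {\<alpha> \<in> multi_idx N. \<forall>i. \<beta> i \<le> \<alpha> i}"
      by (simp only: has_sum_shift_idx[OF \<beta>])
    also have "?this \<longleftrightarrow> (F has_sum s) (multi_idx N)"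
      by (rule has_sum_cong_neutral) (auto intro!: that(2) simp: c'_def)
    finally show ?thesis .
  qed
  have "((\<lambda>\<alpha>. norm (c' \<alpha>) * monom N (\<lambda>_. \<rho>) \<alpha>) has_sum (norm a * monom N (\<lambda>_. \<rho>) \<beta> * S)) (multi_idx N)"
  proof (rule shift)
    show "((\<lambda>\<alpha>. norm (c' (\<lambda>i. \<alpha> i + \<beta> i)) * monom N (\<lambda>_. \<rho>) (\<lambda>i. \<alpha> i + \<beta> i)) has_sum
        norm a * monom N (\<lambda>_. \<rho>) \<beta> * S) (multi_idx N)"
      using has_sum_cmult_right[OF S(1), of "norm a * monom N (\<lambda>_. \<rho>) \<beta>"]
      unfolding c' monom_add by (simp add: norm_mult mult_ac)
  qed simp
  moreover have "((\<lambda>\<alpha>. c' \<alpha> * monom N x \<alpha>) has_sum (a * monom N x \<beta> * g x)) (multi_idx N)"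
    if "\<forall>i<N. norm (x i) \<le> \<rho>" for x
  proof (rule shift)
    show "((\<lambda>\<alpha>. c' (\<lambda>i. \<alpha> i + \<beta> i) * monom N x (\<lambda>i. \<alpha> i + \<beta> i)) has_sum
        a * monom N x \<beta> * g x) (multi_idx N)"
      using has_sum_cmult_right[OF g[OF that], of "a * monom N x \<beta>"]
      unfolding c' monom_add by (simp add: mult_ac)
  qed simp
  moreover have "norm a * monom N (\<lambda>_. \<rho>) \<beta> * S \<le> norm a * monom N (\<lambda>_. \<rho>) \<beta> * B"
    using S(2) less_imp_le[OF monom_pos[of N "\<lambda>_. \<rho>" \<beta>]] assms(2) by (intro mult_left_mono) auto
  ultimately show ?thesis unfolding maj_def by blast
qed

lemma maj_monom:
  assumes "0 < \<rho>" "\<beta> \<in> multi_idx N"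
  shows "maj N \<rho> (monom N (\<lambda>_. \<rho>) \<beta>) (\<lambda>x. monom N x \<beta> :: 'k::{real_normed_field,banach})"
  using maj_monom_mult[OF maj_const[OF assms(1), of N "1::'k"] assms, of 1] by simp

lemma maj_add:
  assumes "maj N \<rho> B g" "maj N \<rho> C h" "0 < \<rho>"
  shows "maj N \<rho> (B + C) (\<lambda>x. g x + h x)"
proof (rule maj_has_sum[where K = UNIV and g = "\<lambda>b. if b then g else h" and B = "\<lambda>b. if b then B else C"])
  show "((\<lambda>b. if b then B else C) has_sum B + C) UNIV"
    by (simp add: has_sum_finite_iff UNIV_bool)
  show "((\<lambda>b. (if b then g else h) x) has_sum g x + h x) UNIV" for x
    by (simp add: has_sum_finite_iff UNIV_bool)
qed (use assms in auto)

text \<open>Only the first factor is expanded: the product becomes a sum of monomial multiples of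
  \<open>h\<close>, whose bounds \<open>norm (c \<alpha>) * monom N (\<lambda>_. \<rho>) \<alpha> *
  C\<close> add up to \<open>S * C\<close>.\<close>

lemma maj_mult:
  assumes "maj N \<rho> B g" "maj N \<rho> C h" and \<rho>: "0 < \<rho>"
  shows "maj N \<rho> (B * C) (\<lambda>x. g x * h x)"
proof -
  from assms(1) obtain c S where
    S: "((\<lambda>\<alpha>. norm (c \<alpha>) * monom N (\<lambda>_. \<rho>) \<alpha>) has_sum S) (multi_idx N)" "S \<le> B" and
    g: "\<And>x. (\<forall>i<N. norm (x i) \<le> \<rho>) \<Longrightarrow> ((\<lambda>\<alpha>. c \<alpha> * monom N x \<alpha>) has_sum g x) (multi_idx N)"
    unfolding maj_def by blast
  have "maj N \<rho> (S * C) (\<lambda>x. g x * h x)"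
    by (rule maj_has_sum[OF \<rho> maj_monom_mult[OF assms(2) \<rho>]])
      (auto intro: has_sum_cmult_left[OF S(1)] has_sum_cmult_left[OF g])
  \<comment> \<open>The sign is needed to pass from \<open>S\<close> to the larger \<open>B\<close>;
    it comes from the bound on the value at the origin.\<close>
  moreover have "0 \<le> C"
    using maj_bound[OF assms(2), of "\<lambda>_. 0"] \<rho> by (simp add: order_trans[OF norm_ge_zero])
  then have "S * C \<le> B * C"
    using S(2) by (rule mult_right_mono[rotated])
  ultimately show ?thesis
    using maj_mono[OF _ \<rho>] by blast
qed

lemma maj_power:
  assumes "maj N \<rho> B g" "0 < \<rho>"
  shows "maj N \<rho> (B ^ k) (\<lambda>x. g x ^ k)"
proof (induction k)
  case 0
  show ?case using maj_const[OF assms(2), of N 1] by simp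
qed (use maj_mult[OF assms(1) _ assms(2)] in simp)

lemma maj_compose_monom:
  assumes "\<And>j. j < P \<Longrightarrow> maj N \<rho> B (\<lambda>x. \<phi> x j)" "0 < \<rho>"
  shows "maj N \<rho> (monom P (\<lambda>_. B) \<alpha>) (\<lambda>x. monom P (\<phi> x) \<alpha>)"
  using assms(1)
proof (induction P)
  case 0
  show ?case using maj_const[OF assms(2), of N 1] by simp
next
  case (Suc P)
  then show ?case
    unfolding monom_Suc by (intro maj_mult maj_power assms(2)) auto
qed

text \<open>The norm bound on the components of \<open>\<phi>\<close> equals the radius
  \<open>\<sigma>\<close> at which \<open>g\<close> is majorised, so the monomials of
  \<open>\<phi>\<close> are bounded by exactly the weights in the norm of \<open>g\<close>.\<close>

lemma maj_compose:
  assumes g: "maj P \<sigma> B g" and \<phi>: "\<And>j. j < P \<Longrightarrow> maj N \<rho> \<sigma> (\<lambda>x. \<phi> x j)" and \<rho>: "0 < \<rho>"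
  shows "maj N \<rho> B (\<lambda>x. g (\<phi> x))"
proof -
  from g obtain c S where
    S: "((\<lambda>\<alpha>. norm (c \<alpha>) * monom P (\<lambda>_. \<sigma>) \<alpha>) has_sum S) (multi_idx P)" "S \<le> B" and
    g: "\<And>x. (\<forall>i<P. norm (x i) \<le> \<sigma>) \<Longrightarrow> ((\<lambda>\<alpha>. c \<alpha> * monom P x \<alpha>) has_sum g x) (multi_idx P)"
    unfolding maj_def by blast
  have "maj N \<rho> S (\<lambda>x. g (\<phi> x))"
  proof (rule maj_has_sum[OF \<rho> _ S(1)])
    show "maj N \<rho> (norm (c \<alpha>) * monom P (\<lambda>_. \<sigma>) \<alpha>) (\<lambda>x. c \<alpha> * monom P (\<phi> x) \<alpha>)" for \<alpha>
      by (intro maj_mult maj_const maj_compose_monom \<phi> \<rho>)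
    \<comment> \<open>The norm also bounds values, so \<open>\<phi> x\<close> lies in the polydisc
      where the series of \<open>g\<close> converges.\<close>
    show "((\<lambda>\<alpha>. c \<alpha> * monom P (\<phi> x) \<alpha>) has_sum g (\<phi> x)) (multi_idx P)"
      if "\<forall>i<N. norm (x i) \<le> \<rho>" for x
      using that maj_bound[OF \<phi>] by (intro g) auto
  qed
  with S(2) \<rho> show ?thesis
    using maj_mono by blast
qed

text \<open>Without constant term every monomial that occurs has positive degree, so shrinking the
  radius by a factor \<open>\<theta>\<close> gains at least a factor \<open>\<theta>\<close> in the
  norm. This is how inner maps vanishing at the origin are made to fit the radius required by
  \<open>maj_compose\<close>.\<close>

lemma maj_small:
  assumes g: "maj N \<rho> B g" and \<rho>: "0 < \<rho>" and 0: "g (\<lambda>_. 0) = 0" and \<epsilon>: "0 < \<epsilon>"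
  shows "\<exists>r. 0 < r \<and> r \<le> \<rho> \<and> maj N r \<epsilon> g"
proof -
  from g obtain c S where
    S: "((\<lambda>\<alpha>. norm (c \<alpha>) * monom N (\<lambda>_. \<rho>) \<alpha>) has_sum S) (multi_idx N)" "S \<le> B" and
    g: "\<And>x. (\<forall>i<N. norm (x i) \<le> \<rho>) \<Longrightarrow> ((\<lambda>\<alpha>. c \<alpha> * monom N x \<alpha>) has_sum g x) (multi_idx N)"
    unfolding maj_def by blast
  have nz: "\<exists>i<N. \<alpha> i \<noteq> 0" if "\<alpha> \<in> multi_idx N" "\<alpha> \<noteq> (\<lambda>_. 0)" for \<alpha>
  proof (rule ccontr)
    assume "\<not> ?thesis"
    then have "\<alpha> i = 0" for i
      using that(1) by (cases "i < N") (auto simp: multi_idx_def)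
    with that(2) show False by auto
  qed
  \<comment> \<open>At the origin only the constant term survives, so uniqueness of sums identifies
    the constant coefficient with the value of \<open>g\<close>.\<close>
  have "((\<lambda>\<alpha>. c \<alpha> * monom N (\<lambda>_. 0) \<alpha>) has_sum c (\<lambda>_. 0) * monom N (\<lambda>_. 0) (\<lambda>_. 0)) (multi_idx N)"
  proof (rule has_sum_supported[of "\<lambda>_. 0"])
    show "c \<alpha> * monom N (\<lambda>_. 0) \<alpha> = 0" if "\<alpha> \<in> multi_idx N" "\<alpha> \<noteq> (\<lambda>_. 0)" for \<alpha>
      using nz[OF that] monom_eq_0[of _ N "\<lambda>_. 0" \<alpha>] by auto
  qed simp
  then have c0: "c (\<lambda>_. 0) = 0"
    using has_sum_unique[OF g[of "\<lambda>_. 0"]] 0 \<rho> by simp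
  \<comment> \<open>Chosen for \<open>\<theta> * S \<le> \<epsilon>\<close>; the summand 1 keeps the
    denominator positive.\<close>
  define \<theta> where "\<theta> = min 1 (\<epsilon> / (\<bar>S\<bar> + 1))"
  have \<theta>: "0 < \<theta>" "\<theta> \<le> 1" "\<theta> * S \<le> \<epsilon>"
  proof -
    show "0 < \<theta>" "\<theta> \<le> 1" using \<epsilon> by (auto simp: \<theta>_def)
    have "\<theta> * S \<le> \<theta> * (\<bar>S\<bar> + 1)" using \<open>0 < \<theta>\<close> by (intro mult_left_mono) auto
    also have "\<dots> \<le> \<epsilon> / (\<bar>S\<bar> + 1) * (\<bar>S\<bar> + 1)" by (intro mult_right_mono) (auto simp: \<theta>_def)
    finally show "\<theta> * S \<le> \<epsilon>" by simp
  qed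
  have mono: "monom N (\<lambda>_. \<theta> * \<rho>) \<alpha> \<le> \<theta> * monom N (\<lambda>_. \<rho>) \<alpha>" if \<alpha>: "\<alpha> \<in> multi_idx N" "\<alpha> \<noteq> (\<lambda>_. 0)" for \<alpha>
  proof -
    obtain i where i: "i < N" "\<alpha> i \<noteq> 0" using nz[OF \<alpha>] by blast
    have "monom N (\<lambda>_. \<theta>) \<alpha> = \<theta> ^ \<alpha> i * (\<Prod>j\<in>{..<N}-{i}. \<theta> ^ \<alpha> j)"
      unfolding monom_def using i by (subst prod.remove[of _ i]) auto
    also have "\<dots> \<le> \<theta> ^ \<alpha> i * 1"
      using \<theta> by (intro mult_left_mono prod_le_1) (auto intro: power_le_one)
    also have "\<dots> \<le> \<theta>"
      using \<theta> i power_decreasing[of 1 "\<alpha> i" \<theta>] by simp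
    finally show ?thesis
      unfolding monom_mult using monom_pos[of N "\<lambda>_. \<rho>" \<alpha>] \<rho>
      by (intro mult_right_mono) auto
  qed
  have "\<exists>S'. ((\<lambda>\<alpha>. norm (c \<alpha>) * monom N (\<lambda>_. \<theta> * \<rho>) \<alpha>) has_sum S') (multi_idx N) \<and> S' \<le> \<epsilon>"
  proof (rule has_sum_le_of_comparison[OF has_sum_cmult_right[OF S(1), of \<theta>]])
    show "0 \<le> norm (c \<alpha>) * monom N (\<lambda>_. \<theta> * \<rho>) \<alpha> \<and>
        norm (c \<alpha>) * monom N (\<lambda>_. \<theta> * \<rho>) \<alpha> \<le> \<theta> * (norm (c \<alpha>) * monom N (\<lambda>_. \<rho>) \<alpha>)"
      if "\<alpha> \<in> multi_idx N" for \<alpha>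
    proof (cases "\<alpha> = (\<lambda>_. 0)")
      case False
      have "norm (c \<alpha>) * monom N (\<lambda>_. \<theta> * \<rho>) \<alpha> \<le> norm (c \<alpha>) * (\<theta> * monom N (\<lambda>_. \<rho>) \<alpha>)"
        by (intro mult_left_mono mono that False) auto
      moreover have "0 \<le> monom N (\<lambda>_. \<theta> * \<rho>) \<alpha>"
        using \<theta> \<rho> by (intro less_imp_le[OF monom_pos]) auto
      ultimately show ?thesis by (simp add: mult_ac)
    qed (simp add: c0)
  qed (rule \<theta>)
  moreover have "\<theta> * \<rho> \<le> \<rho>"
    using \<theta> \<rho> mult_right_mono[of \<theta> 1 \<rho>] by simp
  moreover have "((\<lambda>\<alpha>. c \<alpha> * monom N x \<alpha>) has_sum g x) (multi_idx N)" if "\<forall>i<N. norm (x i) \<le> \<theta> * \<rho>" for x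
    using that \<open>\<theta> * \<rho> \<le> \<rho>\<close> by (intro g) force
  ultimately show ?thesis
    using \<theta> \<rho> unfolding maj_def by (intro exI[of _ "\<theta> * \<rho>"]) auto
qed

text \<open>The exponents split according to whether the \<open>i\<close>-th entry is zero. The
  terms with zero entry sum to the value at \<open>x(i := 0)\<close>; lowering the
  \<open>i\<close>-th exponent of the others by one gives the series of \<open>h\<close>, at the
  cost of a factor \<open>1 / \<rho>\<close> in the norm.\<close>

lemma maj_divide_coordinate:
  assumes g: "maj N \<rho> B g" and \<rho>: "0 < \<rho>" and i: "i < N"
  shows "\<exists>h C. maj N \<rho> C h \<and> (\<forall>x. (\<forall>i<N. norm (x i) \<le> \<rho>) \<longrightarrow> g x = g (x(i := 0)) + x i * h x)"
proof -
  from g obtain c S where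
    S: "((\<lambda>\<alpha>. norm (c \<alpha>) * monom N (\<lambda>_. \<rho>) \<alpha>) has_sum S) (multi_idx N)" "S \<le> B" and
    g: "\<And>x. (\<forall>i<N. norm (x i) \<le> \<rho>) \<Longrightarrow> ((\<lambda>\<alpha>. c \<alpha> * monom N x \<alpha>) has_sum g x) (multi_idx N)"
    unfolding maj_def by blast
  define e where "e = (\<lambda>j. if j = i then 1 else 0 :: nat)"
  have e: "e \<in> multi_idx N" and me: "monom N x e = x i" for x :: "nat \<Rightarrow> 'c::comm_ring_1"
    using i by (auto simp: e_def single_multi_idx monom_single)
  have me': "monom N x e = x i" for x :: "nat \<Rightarrow> real"
    using i by (auto simp: e_def monom_single)
  define d where "d \<alpha> = c (\<lambda>j. \<alpha> j + e j)" for \<alpha>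
  define h where "h x = (\<Sum>\<^sub>\<infinity>\<alpha>\<in>multi_idx N. d \<alpha> * monom N x \<alpha>)" for x
  define M1 where "M1 = {\<alpha> \<in> multi_idx N. \<forall>j. e j \<le> \<alpha> j}"
  define M0 where "M0 = {\<alpha> \<in> multi_idx N. \<alpha> i = 0}"
  have M: "multi_idx N = M0 \<union> M1" "M0 \<inter> M1 = {}"
    by (auto simp: M0_def M1_def e_def)
  have "(\<lambda>\<alpha>. norm (c \<alpha>) * monom N (\<lambda>_. \<rho>) \<alpha>) summable_on M1"
    by (rule summable_on_subset_banach[where A = "multi_idx N"]) (use S M in \<open>auto simp: summable_on_def\<close>)
  then obtain s where "((\<lambda>\<alpha>. norm (c \<alpha>) * monom N (\<lambda>_. \<rho>) \<alpha>) has_sum s) M1"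
    by (auto simp: summable_on_def)
  then have "((\<lambda>\<alpha>. norm (c (\<lambda>j. \<alpha> j + e j)) * monom N (\<lambda>_. \<rho>) (\<lambda>j. \<alpha> j + e j)) has_sum s) (multi_idx N)"
    unfolding M1_def by (subst has_sum_shift_idx[OF e])
  then have "((\<lambda>\<alpha>. norm (d \<alpha>) * monom N (\<lambda>_. \<rho>) \<alpha> * \<rho>) has_sum s) (multi_idx N)"
    unfolding monom_add me' d_def by (simp add: mult_ac)
  from has_sum_cmult_left[OF this, of "1 / \<rho>"]
  have d: "((\<lambda>\<alpha>. norm (d \<alpha>) * monom N (\<lambda>_. \<rho>) \<alpha>) has_sum s / \<rho>) (multi_idx N)"
    using \<rho> by (simp add: divide_simps)
  have h: "((\<lambda>\<alpha>. d \<alpha> * monom N x \<alpha>) has_sum h x) (multi_idx N)" if "\<forall>i<N. norm (x i) \<le> \<rho>" for x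
    unfolding h_def by (rule has_sum_infsum, rule abs_summable_summable, rule maj_abs_summable[OF d that])
  have "g x = g (x(i := 0)) + x i * h x" if x: "\<forall>i<N. norm (x i) \<le> \<rho>" for x
  proof -
    have "((\<lambda>\<alpha>. c (\<lambda>j. \<alpha> j + e j) * monom N x (\<lambda>j. \<alpha> j + e j)) has_sum x i * h x) (multi_idx N)"
      using has_sum_cmult_right[OF h[OF x], of "x i"] unfolding monom_add me d_def
      by (simp add: mult_ac)
    then have 1: "((\<lambda>\<alpha>. c \<alpha> * monom N x \<alpha>) has_sum x i * h x) M1"
      unfolding M1_def by (simp only: has_sum_shift_idx[OF e, of "\<lambda>\<alpha>. c \<alpha> * monom N x \<alpha>"])
    have "((\<lambda>\<alpha>. c \<alpha> * monom N (x(i := 0)) \<alpha>) has_sum g (x(i := 0))) (multi_idx N)"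
      using x \<rho> by (intro g) auto
    also have "?this \<longleftrightarrow> ((\<lambda>\<alpha>. c \<alpha> * monom N x \<alpha>) has_sum g (x(i := 0))) M0"
    proof (rule has_sum_cong_neutral)
      show "c \<alpha> * monom N (x(i := 0)) \<alpha> = 0" if "\<alpha> \<in> multi_idx N - M0" for \<alpha>
        using that i by (simp add: M0_def monom_eq_0[of i])
      show "c \<alpha> * monom N (x(i := 0)) \<alpha> = c \<alpha> * monom N x \<alpha>" if "\<alpha> \<in> multi_idx N \<inter> M0" for \<alpha>
        using that by (auto simp: M0_def monom_def intro!: prod.cong)
    qed (auto simp: M0_def)
    finally have "((\<lambda>\<alpha>. c \<alpha> * monom N x \<alpha>) has_sum g (x(i := 0)) + x i * h x) (multi_idx N)"
      unfolding M(1) using 1 M(2) by (rule has_sum_Un_disjoint)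
    from has_sum_unique[OF g[OF x] this] show ?thesis .
  qed
  moreover have "maj N \<rho> (s / \<rho>) h"
    unfolding maj_def using d h by blast
  ultimately show ?thesis by blast
qed

text \<open>Abel's lemma: convergence at the diagonal point \<open>(R, ..., R)\<close> bounds the
  terms there, and at half that radius they are dominated by a multiple of the geometric series with
  ratio 1/2 in every variable.\<close>

lemma analytic0_imp_maj:
  assumes "analytic0 N g"
  shows "\<exists>\<rho> B. 0 < \<rho> \<and> maj N \<rho> B g"
proof -
  from assms obtain c r where r: "r > 0" and
    g: "\<And>x. (\<forall>i<N. norm (x i) < r) \<Longrightarrow> ((\<lambda>\<alpha>. c \<alpha> * monom N x \<alpha>) has_sum g x) (multi_idx N)"
    unfolding analytic0_def by blast
  define R where "R = r / 2"
  have R: "0 < R" "R < r" using r by (auto simp: R_def)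
  define t where "t \<alpha> = c \<alpha> * monom N (\<lambda>_. of_real R) \<alpha>" for \<alpha>
  have "t summable_on multi_idx N"
    unfolding t_def using g[of "\<lambda>_. of_real R"] R by (auto simp: summable_on_def)
  then obtain s where "(t has_sum s) (multi_idx N)" by (auto simp: summable_on_def)
  then have "\<forall>\<^sub>F F in finite_subsets_at_top (multi_idx N). dist (sum t F) s < 1"
    unfolding has_sum_def by (rule tendstoD) simp
  then obtain F0 where F0: "finite F0" "F0 \<subseteq> multi_idx N"
    "\<And>F. finite F \<Longrightarrow> F0 \<subseteq> F \<Longrightarrow> F \<subseteq> multi_idx N \<Longrightarrow> dist (sum t F) s < 1"
    unfolding eventually_finite_subsets_at_top by auto
  \<comment> \<open>A term outside \<open>F0\<close> is the difference of two partial sums that both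
    lie within 1 of \<open>s\<close>, hence the 2; the finitely many terms in \<open>F0\<close> are
    covered by the maximum.\<close>
  define M where "M = Max (insert 2 ((\<lambda>\<alpha>. norm (t \<alpha>)) ` F0))"
  have tM: "norm (t \<alpha>) \<le> M" if "\<alpha> \<in> multi_idx N" for \<alpha>
  proof (cases "\<alpha> \<in> F0")
    case True
    with F0(1) show ?thesis by (simp add: M_def)
  next
    case False
    have "t \<alpha> = sum t (insert \<alpha> F0) - sum t F0"
      using False F0(1) by simp
    then have "norm (t \<alpha>) = dist (sum t (insert \<alpha> F0)) (sum t F0)"
      by (simp only: dist_norm)
    also have "\<dots> \<le> dist (sum t (insert \<alpha> F0)) s + dist (sum t F0) s"
      by (rule dist_triangle2)
    also have "\<dots> \<le> 2"
      using F0(3)[of F0] F0(3)[of "insert \<alpha> F0"] F0(1,2) that by fastforce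
    also have "2 \<le> M"
      using F0(1) by (simp add: M_def)
    finally show ?thesis .
  qed
  define \<rho> where "\<rho> = R / 2"
  have \<rho>: "0 < \<rho>" "\<rho> < r" using R by (auto simp: \<rho>_def)
  have "\<exists>S. ((\<lambda>\<alpha>. norm (c \<alpha>) * monom N (\<lambda>_. \<rho>) \<alpha>) has_sum S) (multi_idx N)"
  proof -
    have "(\<lambda>\<alpha>. M * monom N (\<lambda>_. 1/2::real) \<alpha>) summable_on multi_idx N"
      by (intro summable_on_cmult_right summable_monom_geometric) auto
    then have "(\<lambda>\<alpha>. norm (c \<alpha>) * monom N (\<lambda>_. \<rho>) \<alpha>) summable_on multi_idx N"
    proof (rule summable_on_comparison_test)
      fix \<alpha> assume "\<alpha> \<in> multi_idx N"
      have "norm (t \<alpha>) = norm (c \<alpha>) * monom N (\<lambda>_. R) \<alpha>"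
        using R by (simp add: t_def norm_mult norm_monom)
      moreover have "monom N (\<lambda>_. \<rho>) \<alpha> = monom N (\<lambda>_. R) \<alpha> * monom N (\<lambda>_. 1/2) \<alpha>"
        by (simp add: \<rho>_def flip: monom_mult)
      ultimately have "norm (c \<alpha>) * monom N (\<lambda>_. \<rho>) \<alpha> = norm (t \<alpha>) * monom N (\<lambda>_. 1/2) \<alpha>"
        by simp
      also have "\<dots> \<le> M * monom N (\<lambda>_. 1/2) \<alpha>"
        by (intro mult_right_mono tM less_imp_le[OF monom_pos] \<open>\<alpha> \<in> _\<close>) auto
      finally show "norm (c \<alpha>) * monom N (\<lambda>_. \<rho>) \<alpha> \<le> M * monom N (\<lambda>_. 1/2) \<alpha>" .
      show "0 \<le> norm (c \<alpha>) * monom N (\<lambda>_. \<rho>) \<alpha>"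
        using less_imp_le[OF monom_pos[of N "\<lambda>_. \<rho>" \<alpha>]] \<rho> by simp
    qed
    then show ?thesis by (auto simp: summable_on_def)
  qed
  moreover have "((\<lambda>\<alpha>. c \<alpha> * monom N x \<alpha>) has_sum g x) (multi_idx N)" if "\<forall>i<N. norm (x i) \<le> \<rho>" for x
    using that \<rho>(2) by (intro g) force
  ultimately show ?thesis
    unfolding maj_def using \<rho>(1) by blast
qed

lemma maj_imp_analytic0: "maj N \<rho> B g \<Longrightarrow> 0 < \<rho> \<Longrightarrow> analytic0 N g"
  unfolding maj_def analytic0_def by (meson less_imp_le)

section \<open>Germs of analytic functions\<close>

text \<open>Neighbourhoods of the origin in the first \<open>N\<close> coordinates, as a filter:
  finitely many identities of germs can then be combined, or pulled back along a map, without
  bookkeeping of radii.\<close>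

definition germ0 :: "nat \<Rightarrow> (nat \<Rightarrow> 'k::real_normed_field) filter" where
  "germ0 N = (INF r\<in>{0<..}. principal {x. \<forall>i<N. norm (x i) < r})"

lemma eventually_germ0:
  "eventually Q (germ0 N) \<longleftrightarrow> (\<exists>r>0. \<forall>x. (\<forall>i<N. norm (x i) < r) \<longrightarrow> Q x)"
proof -
  have "eventually Q (germ0 N) \<longleftrightarrow>
      (\<exists>r\<in>{0<..}. eventually Q (principal {x. \<forall>i<N. norm (x i) < r}))"
    unfolding germ0_def
  proof (rule eventually_INF_base)
    show "\<exists>r\<in>{0<..}. principal {x :: nat \<Rightarrow> 'a. \<forall>i<N. norm (x i) < r} \<le>
        inf (principal {x. \<forall>i<N. norm (x i) < a}) (principal {x. \<forall>i<N. norm (x i) < b})"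
      if "a \<in> {0<..}" "b \<in> {0<..}" for a b :: real
      using that by (intro bexI[of _ "min a b"]) auto
  qed auto
  then show ?thesis by (auto simp: eventually_principal)
qed

lemma filterlim_germ0:
  "filterlim \<phi> (germ0 P) F \<longleftrightarrow> (\<forall>j<P. ((\<lambda>x. \<phi> x j) \<longlongrightarrow> 0) F)"
proof
  assume lim: "filterlim \<phi> (germ0 P) F"
  show "\<forall>j<P. ((\<lambda>x. \<phi> x j) \<longlongrightarrow> 0) F"
  proof (intro allI impI tendstoI)
    fix j and e :: real assume "j < P" "0 < e"
    then have "\<forall>\<^sub>F x in germ0 P. dist (x j) 0 < e"
      by (auto simp: eventually_germ0)
    then show "\<forall>\<^sub>F x in F. dist (\<phi> x j) 0 < e"
      by (rule eventually_compose_filterlim[OF _ lim])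
  qed
next
  assume lim: "\<forall>j<P. ((\<lambda>x. \<phi> x j) \<longlongrightarrow> 0) F"
  have "\<forall>\<^sub>F x in F. Q (\<phi> x)" if "eventually Q (germ0 P)" for Q
  proof -
    from that obtain r where r: "r > 0" "\<And>x. (\<forall>i<P. norm (x i) < r) \<Longrightarrow> Q x"
      by (auto simp: eventually_germ0)
    have "\<forall>\<^sub>F x in F. \<forall>j\<in>{..<P}. norm (\<phi> x j) < r"
      by (rule eventually_ball_finite)
        (use lim r(1) in \<open>auto simp: tendsto_iff\<close>)
    then show ?thesis by eventually_elim (auto intro: r(2))
  qed
  then show "filterlim \<phi> (germ0 P) F" by (simp add: filterlim_iff)
qed

lemma germ_eq_iff: "germ_eq N g h \<longleftrightarrow> (\<forall>\<^sub>F x in germ0 N. g x = h x)"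
  by (simp add: germ_eq_def eventually_germ0)

lemma analytic0_common_radius:
  assumes "analytic0 N g" "analytic0 N h"
  shows "\<exists>\<rho> B C. 0 < \<rho> \<and> maj N \<rho> B g \<and> maj N \<rho> C h"
proof -
  obtain \<rho>1 B \<rho>2 C where "0 < \<rho>1" "maj N \<rho>1 B g" "0 < \<rho>2" "maj N \<rho>2 C h"
    using assms[THEN analytic0_imp_maj] by blast
  then have "0 < min \<rho>1 \<rho>2" "maj N (min \<rho>1 \<rho>2) B g" "maj N (min \<rho>1 \<rho>2) C h"
    by (auto elim!: maj_mono)
  then show ?thesis by blast
qed

lemma analytic0_const [simp, intro]: "analytic0 N (\<lambda>_. a)"
  by (rule maj_imp_analytic0[OF maj_const[of 1]]) auto

lemma analytic0_monom: "\<beta> \<in> multi_idx N \<Longrightarrow> analytic0 N (\<lambda>x. monom N x \<beta>)"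
  by (rule maj_imp_analytic0[OF maj_monom[of 1]]) auto

lemma analytic0_coordinate: "i < N \<Longrightarrow> analytic0 N (\<lambda>x. x i)"
  using analytic0_monom[OF single_multi_idx[of i N 1]] by (simp add: monom_single)

lemma analytic0_add: "analytic0 N g \<Longrightarrow> analytic0 N h \<Longrightarrow> analytic0 N (\<lambda>x. g x + h x)"
  using analytic0_common_radius[of N g h] maj_add maj_imp_analytic0 by blast

lemma analytic0_mult: "analytic0 N g \<Longrightarrow> analytic0 N h \<Longrightarrow> analytic0 N (\<lambda>x. g x * h x)"
  using analytic0_common_radius[of N g h] maj_mult maj_imp_analytic0 by blast

lemma analytic0_diff: "analytic0 N g \<Longrightarrow> analytic0 N h \<Longrightarrow> analytic0 N (\<lambda>x. g x - h x)"
  using analytic0_add[of N g "\<lambda>x. (- 1) * h x"] analytic0_mult[of N "\<lambda>_. - 1" h] by simp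

lemma analytic0_if:
  "(c \<Longrightarrow> analytic0 N g) \<Longrightarrow> (\<not> c \<Longrightarrow> analytic0 N h) \<Longrightarrow> analytic0 N (\<lambda>x. if c then g x else h x)"
  by (cases c) auto

lemma analytic0_sum:
  "(\<And>k. k \<in> A \<Longrightarrow> analytic0 N (g k)) \<Longrightarrow> analytic0 N (\<lambda>x. \<Sum>k\<in>A. g k x)"
  by (induction A rule: infinite_finite_induct) (auto intro: analytic0_add)

lemma analytic0_cong:
  assumes "analytic0 N g" "\<forall>\<^sub>F x in germ0 N. g x = h x"
  shows "analytic0 N h"
proof -
  obtain c r where "r > 0" and
    g: "\<And>x. (\<forall>i<N. norm (x i) < r) \<Longrightarrow> ((\<lambda>\<alpha>. c \<alpha> * monom N x \<alpha>) has_sum g x) (multi_idx N)"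
    using assms(1) unfolding analytic0_def by blast
  obtain s where "s > 0" and s: "\<And>x. (\<forall>i<N. norm (x i) < s) \<Longrightarrow> g x = h x"
    using assms(2) unfolding eventually_germ0 by blast
  have "((\<lambda>\<alpha>. c \<alpha> * monom N x \<alpha>) has_sum h x) (multi_idx N)" if "\<forall>i<N. norm (x i) < min r s" for x
    using g[of x] s[of x] that by simp
  with \<open>r > 0\<close> \<open>s > 0\<close> show ?thesis
    unfolding analytic0_def by (intro exI[of _ c] exI[of _ "min r s"]) auto
qed

text \<open>The power series reads only the first \<open>N\<close> coordinates. This is what allows
  points that differ in the irrelevant coordinates to be exchanged.\<close>

lemma analytic0_depends:
  assumes "analytic0 N g"
  shows "\<forall>\<^sub>F x in germ0 N. \<forall>y. (\<forall>i<N. y i = x i) \<longrightarrow> g y = g x"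
proof -
  obtain c r where "r > 0" and
    g: "\<And>x. (\<forall>i<N. norm (x i) < r) \<Longrightarrow> ((\<lambda>\<alpha>. c \<alpha> * monom N x \<alpha>) has_sum g x) (multi_idx N)"
    using assms(1) unfolding analytic0_def by blast
  have "g y = g x" if "\<forall>i<N. norm (x i) < r" "\<forall>i<N. y i = x i" for x y
  proof -
    have "monom N y \<alpha> = monom N x \<alpha>" for \<alpha>
      by (rule monom_cong) (use that in auto)
    then show ?thesis
      using g[of x] g[of y] that by (auto intro: has_sum_unique)
  qed
  with \<open>r > 0\<close> show ?thesis unfolding eventually_germ0 by blast
qed

lemma analytic0_bounded:
  assumes "analytic0 N g"
  shows "\<exists>B. \<forall>\<^sub>F x in germ0 N. norm (g x) \<le> B"
proof -
  obtain \<rho> B where "0 < \<rho>" "maj N \<rho> B g"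
    using assms analytic0_imp_maj by blast
  then show ?thesis
    unfolding eventually_germ0 by (meson maj_bound less_imp_le)
qed

lemma analytic0_small:
  fixes P :: nat
  assumes "\<And>j. j < P \<Longrightarrow> analytic0 N (\<lambda>x. \<phi> x j)" "\<And>j. j < P \<Longrightarrow> \<phi> (\<lambda>_. 0) j = 0" "0 < \<epsilon>"
  shows "\<exists>\<rho>>0. \<forall>j<P. maj N \<rho> \<epsilon> (\<lambda>x. \<phi> x j)"
  using assms(1,2)
proof (induction P)
  case 0
  show ?case by (intro exI[of _ 1]) auto
next
  case (Suc P)
  then obtain \<rho> where \<rho>: "\<rho> > 0" "\<And>j. j < P \<Longrightarrow> maj N \<rho> \<epsilon> (\<lambda>x. \<phi> x j)" by auto
  obtain \<sigma> B where "\<sigma> > 0" "maj N \<sigma> B (\<lambda>x. \<phi> x P)"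
    using Suc.prems(1)[of P] analytic0_imp_maj by blast
  with maj_small[of N \<sigma> B "\<lambda>x. \<phi> x P" \<epsilon>] Suc.prems(2)[of P] \<open>0 < \<epsilon>\<close>
  obtain r where r: "0 < r" "maj N r \<epsilon> (\<lambda>x. \<phi> x P)" by auto
  have "maj N (min r \<rho>) \<epsilon> (\<lambda>x. \<phi> x j)" if "j < Suc P" for j
    using that \<rho> r maj_mono[OF \<rho>(2)[of j]] maj_mono[OF r(2)] by (cases "j = P") auto
  with r \<rho> show ?case by (intro exI[of _ "min r \<rho>"]) auto
qed

lemma analytic0_compose:
  assumes "analytic0 P g" "\<And>j. j < P \<Longrightarrow> analytic0 N (\<lambda>x. \<phi> x j)" "\<And>j. j < P \<Longrightarrow> \<phi> (\<lambda>_. 0) j = 0"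
  shows "analytic0 N (\<lambda>x. g (\<phi> x))"
proof -
  obtain \<sigma> B where \<sigma>: "\<sigma> > 0" "maj P \<sigma> B g"
    using assms(1) analytic0_imp_maj by blast
  obtain \<rho> where "\<rho> > 0" "\<forall>j<P. maj N \<rho> \<sigma> (\<lambda>x. \<phi> x j)"
    using analytic0_small[of P N \<phi> \<sigma>] assms(2,3) \<sigma>(1) by auto
  with \<sigma> show ?thesis
    using maj_compose[of P \<sigma> B g N \<rho> \<phi>] maj_imp_analytic0 by blast
qed

lemma analytic0_tendsto_0:
  assumes "analytic0 N g" "g (\<lambda>_. 0) = 0"
  shows "(g \<longlongrightarrow> 0) (germ0 N)"
proof (rule tendstoI)
  fix e :: real assume "0 < e"
  obtain \<rho> where \<rho>: "\<rho> > 0" "maj N \<rho> (e / 2) g"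
    using analytic0_small[of 1 N "\<lambda>x _. g x" "e / 2"] assms \<open>0 < e\<close> by auto
  have "norm (g x) < e" if "\<forall>i<N. norm (x i) < \<rho>" for x
  proof -
    have "norm (g x) \<le> e / 2"
      using that by (intro maj_bound[OF \<rho>(2)]) auto
    with \<open>0 < e\<close> show ?thesis by simp
  qed
  with \<rho>(1) show "\<forall>\<^sub>F x in germ0 N. dist (g x) 0 < e"
    unfolding eventually_germ0 by auto
qed

lemma filterlim_germ0_analytic:
  assumes "\<And>j. j < P \<Longrightarrow> analytic0 N (\<lambda>x. \<phi> x j)" "\<And>j. j < P \<Longrightarrow> \<phi> (\<lambda>_. 0) j = 0"
  shows "filterlim \<phi> (germ0 P) (germ0 N)"
  unfolding filterlim_germ0 using assms analytic0_tendsto_0 by blast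

section \<open>Hadamard division and the increment formula\<close>

text \<open>Coordinates are set to zero one at a time, each step dividing out one coordinate.
  Stopping at \<open>k < N\<close> matters: in doubled variables only the increment is to be set to
  zero.\<close>

lemma analytic0_expand_first:
  assumes g: "analytic0 N g" and "k \<le> N"
  shows "\<exists>H. (\<forall>i<k. analytic0 N (H i)) \<and>
    (\<forall>\<^sub>F x in germ0 N. g x = g (\<lambda>j. if j < k then 0 else x j) + (\<Sum>i<k. x i * H i x))"
  using \<open>k \<le> N\<close>
proof (induction k)
  case 0
  show ?case by simp
next
  case (Suc k)
  then obtain H where H: "\<forall>i<k. analytic0 N (H i)"
    "\<forall>\<^sub>F x in germ0 N. g x = g (\<lambda>j. if j < k then 0 else x j) + (\<Sum>i<k. x i * H i x)"
    by auto
  \<comment> \<open>The new quotient is taken at \<open>z x\<close>, where the first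
    \<open>k\<close> coordinates are already zero, because the step expands the remainder term of
    the induction hypothesis.\<close>
  define z where "z x = (\<lambda>j. if j < k then 0 else x j)" for x :: "nat \<Rightarrow> 'a"
  obtain \<rho> B where \<rho>: "0 < \<rho>" "maj N \<rho> B g"
    using g analytic0_imp_maj by blast
  obtain h C where h: "maj N \<rho> C h" "\<And>x. (\<forall>i<N. norm (x i) \<le> \<rho>) \<Longrightarrow> g x = g (x(k := 0)) + x k * h x"
    using maj_divide_coordinate[OF \<rho>(2,1), of k] Suc.prems by auto
  have "analytic0 N h"
    using maj_imp_analytic0[OF h(1) \<rho>(1)] .
  then have hz: "analytic0 N (\<lambda>x. h (z x))"
    by (rule analytic0_compose) (auto simp: z_def intro!: analytic0_if analytic0_coordinate)
  have "\<forall>\<^sub>F x in germ0 N. g (z x) = g ((z x)(k := 0)) + z x k * h (z x)"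
    unfolding eventually_germ0
    using \<rho>(1) by (intro exI[of _ \<rho>] conjI allI impI h(2)) (auto simp: z_def intro: less_imp_le)
  with H(2) have "\<forall>\<^sub>F x in germ0 N. g x = g (\<lambda>j. if j < Suc k then 0 else x j) +
      (\<Sum>i<Suc k. x i * (H(k := \<lambda>x. h (z x))) i x)"
  proof eventually_elim
    case (elim x)
    have "(z x)(k := 0) = (\<lambda>j. if j < Suc k then 0 else x j)"
      by (auto simp: z_def fun_eq_iff less_Suc_eq)
    with elim show ?case by (simp add: z_def)
  qed
  moreover have "\<forall>i<Suc k. analytic0 N ((H(k := \<lambda>x. h (z x))) i)"
    using H(1) hz by (auto simp: less_Suc_eq)
  ultimately show ?case by blast
qed

lemma analytic0_hadamard:
  assumes "analytic0 N g"
  shows "\<exists>H. (\<forall>i<N. analytic0 N (H i)) \<and>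
    (\<forall>\<^sub>F x in germ0 N. g x = g (\<lambda>_. 0) + (\<Sum>i<N. x i * H i x))"
proof -
  obtain H where H: "\<forall>i<N. analytic0 N (H i)"
    "\<forall>\<^sub>F x in germ0 N. g x = g (\<lambda>j. if j < N then 0 else x j) + (\<Sum>i<N. x i * H i x)"
    using analytic0_expand_first[OF assms order_refl] by blast
  obtain r where "r > 0" and r: "\<And>x y. (\<forall>i<N. norm (x i) < r) \<Longrightarrow> \<forall>i<N. y i = x i \<Longrightarrow> g y = g x"
    using analytic0_depends[OF assms] unfolding eventually_germ0 by blast
  \<comment> \<open>The two points agree only in the coordinates below \<open>N\<close>.\<close>
  have "g (\<lambda>j. if j < N then 0 else x j) = g (\<lambda>_. 0)" for x
    by (rule r) (use \<open>r > 0\<close> in auto)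
  with H show ?thesis by auto
qed

text \<open>The germ \<open>g(v + x)\<close> in the doubled variables \<open>(v, x)\<close> is
  expanded in \<open>v\<close> alone; \<open>join N v x\<close> lists the increment first to match
  \<open>analytic0_expand_first\<close>.\<close>

lemma analytic0_difference:
  assumes g: "analytic0 N g"
  shows "\<exists>H r. (\<forall>i<N. analytic0 (N + N) (H i)) \<and> r > 0 \<and>
    (\<forall>x v. (\<forall>i<N. norm (x i) < r) \<longrightarrow> (\<forall>i<N. norm (v i) < r) \<longrightarrow>
      g (\<lambda>i. x i + v i) = g x + (\<Sum>i<N. v i * H i (join N v x)))"
proof -
  define s where "s z = (\<lambda>i. z i + z (i + N))" for z :: "nat \<Rightarrow> 'a"
  have "analytic0 (N + N) (\<lambda>z. g (s z))"
    by (rule analytic0_compose[OF g]) (auto simp: s_def intro!: analytic0_add analytic0_coordinate)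
  from analytic0_expand_first[OF this, of N] obtain H where H: "\<forall>i<N. analytic0 (N + N) (H i)"
    "\<forall>\<^sub>F z in germ0 (N + N). g (s z) = g (s (\<lambda>j. if j < N then 0 else z j)) + (\<Sum>i<N. z i * H i z)"
    by auto
  from H(2) obtain r where "r > 0" and r: "\<And>z. \<forall>i<N + N. norm (z i) < r \<Longrightarrow>
      g (s z) = g (s (\<lambda>j. if j < N then 0 else z j)) + (\<Sum>i<N. z i * H i z)"
    unfolding eventually_germ0 by blast
  obtain r' where "r' > 0" and r': "\<And>x y. (\<forall>i<N. norm (x i) < r') \<Longrightarrow> \<forall>i<N. y i = x i \<Longrightarrow> g y = g x"
    using analytic0_depends[OF g] unfolding eventually_germ0 by blast
  \<comment> \<open>Half of \<open>r'\<close> keeps the sum \<open>x + v\<close> inside the polydisc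
    where \<open>g\<close> ignores the coordinates from \<open>N\<close> on.\<close>
  define r0 where "r0 = min r (r' / 2)"
  have r0: "r0 > 0" "r0 \<le> r" "r0 \<le> r' / 2" "r0 < r'"
    using \<open>r > 0\<close> \<open>r' > 0\<close> by (auto simp: r0_def)
  have "g (\<lambda>i. x i + v i) = g x + (\<Sum>i<N. v i * H i (join N v x))"
    if x: "\<forall>i<N. norm (x i) < r0" and v: "\<forall>i<N. norm (v i) < r0" for x v
  proof -
    define z where "z = join N v x"
    have "norm (z i) < r" if "i < N + N" for i
    proof -
      have "i - N < N" if "\<not> i < N" using that \<open>i < N + N\<close> by auto
      then show ?thesis
        using x v r0(2) by (auto simp: z_def join_def intro: less_le_trans)
    qed
    then have "g (s z) = g (s (\<lambda>j. if j < N then 0 else z j)) + (\<Sum>i<N. z i * H i z)"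
      by (intro r) auto
    moreover have "g (s z) = g (\<lambda>i. x i + v i)"
    proof (rule r')
      show "\<forall>i<N. norm (x i + v i) < r'"
        using x v r0(3) by (intro allI impI norm_triangle_lt) (fastforce simp: field_simps)
    qed (auto simp: s_def z_def join_def)
    moreover have "g (s (\<lambda>j. if j < N then 0 else z j)) = g x"
    proof (rule r')
      show "\<forall>i<N. norm (x i) < r'"
        using x r0(4) by force
    qed (auto simp: s_def z_def join_def)
    moreover have "(\<Sum>i<N. z i * H i z) = (\<Sum>i<N. v i * H i z)"
      by (intro sum.cong) (auto simp: z_def join_def)
    ultimately show ?thesis
      by (simp add: z_def)
  qed
  with H(1) r0(1) show ?thesis by blast
qed

section \<open>Continuity, partial derivatives and the chain rule\<close>

lemma eventually_norm_less:
  fixes l :: "nat \<Rightarrow> 'k::real_normed_field"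
  assumes "\<And>i. i < N \<Longrightarrow> ((\<lambda>t. \<gamma> t i) \<longlongrightarrow> l i) F" "0 < r"
  shows "\<forall>\<^sub>F t in F. \<forall>i<N. norm (\<gamma> t i - l i) < r"
proof -
  have "\<forall>\<^sub>F t in F. \<forall>i\<in>{..<N}. dist (\<gamma> t i) (l i) < r"
    by (rule eventually_ball_finite) (use assms in \<open>auto intro: tendstoD\<close>)
  then show ?thesis by eventually_elim (auto simp: dist_norm)
qed

lemma uniform_radius:
  assumes "\<And>i. i < (N::nat) \<Longrightarrow> \<exists>r>0. Q i r" "\<And>i r s. Q i r \<Longrightarrow> 0 < s \<Longrightarrow> s \<le> r \<Longrightarrow> Q i s"
  shows "\<exists>r>(0::real). \<forall>i<N. Q i r"
  using assms(1)
proof (induction N)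
  case 0
  show ?case by (intro exI[of _ 1]) auto
next
  case (Suc N)
  then obtain r s where "r > 0" "\<forall>i<N. Q i r" "s > 0" "Q N s"
    by (meson lessI less_SucI)
  then show ?case
    by (intro exI[of _ "min r s"]) (auto simp: less_Suc_eq intro: assms(2))
qed

text \<open>In the increment formula at \<open>l\<close> each summand is a null function times a
  bounded one. Convergence is asked coordinatewise and along an arbitrary filter, the form in which
  it is applied to difference quotients.\<close>

lemma analytic0_continuous:
  assumes h: "analytic0 N h"
  shows "\<exists>r>0. \<forall>l \<gamma> F. (\<forall>i<N. norm (l i) < r) \<longrightarrow> (\<forall>i<N. ((\<lambda>t. \<gamma> t i) \<longlongrightarrow> l i) F) \<longrightarrow>
    ((\<lambda>t. h (\<gamma> t)) \<longlongrightarrow> h l) (F :: 'b filter)"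
proof -
  obtain H r where H: "\<And>i. i < N \<Longrightarrow> analytic0 (N + N) (H i)" and "r > 0" and
    r: "\<And>x v. \<forall>i<N. norm (x i) < r \<Longrightarrow> \<forall>i<N. norm (v i) < r \<Longrightarrow>
      h (\<lambda>i. x i + v i) = h x + (\<Sum>i<N. v i * H i (join N v x))"
    using analytic0_difference[OF h] by blast
  have "\<exists>s>0. \<forall>i<N. \<exists>B. \<forall>z. (\<forall>j<N + N. norm (z j) < s) \<longrightarrow> norm (H i z) \<le> B"
  proof (rule uniform_radius)
    show "\<exists>s>0. \<exists>B. \<forall>z. (\<forall>j<N + N. norm (z j) < s) \<longrightarrow> norm (H i z) \<le> B" if "i < N" for i
      using analytic0_bounded[OF H[OF that]] unfolding eventually_germ0 by blast
  next
    fix i and r s :: real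
    assume "\<exists>B. \<forall>z. (\<forall>j<N + N. norm (z j) < r) \<longrightarrow> norm (H i z) \<le> B" "s \<le> r"
    then show "\<exists>B. \<forall>z. (\<forall>j<N + N. norm (z j) < s) \<longrightarrow> norm (H i z) \<le> B"
      by (meson less_le_trans)
  qed
  then obtain s B where "s > 0" and
    s: "\<And>i z. i < N \<Longrightarrow> \<forall>j<N + N. norm (z j) < s \<Longrightarrow> norm (H i z) \<le> B i"
    by metis
  have "((\<lambda>t. h (\<gamma> t)) \<longlongrightarrow> h l) F"
    if l: "\<forall>i<N. norm (l i) < min r s" and \<gamma>: "\<forall>i<N. ((\<lambda>t. \<gamma> t i) \<longlongrightarrow> l i) F"
    for l \<gamma> and F :: "'b filter"
  proof -
    define v where "v t = (\<lambda>i. \<gamma> t i - l i)" for t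
    have "\<forall>\<^sub>F t in F. \<forall>i<N. norm (v t i) < min r s"
      unfolding v_def by (rule eventually_norm_less) (use \<gamma> \<open>r > 0\<close> \<open>s > 0\<close> in auto)
    moreover have "norm (join N (v t) l j) < s" if "\<forall>i<N. norm (v t i) < min r s" "j < N + N" for t j
      using that l by (cases "j < N") (auto simp: join_def)
    ultimately have ev: "\<forall>\<^sub>F t in F. (\<forall>i<N. norm (v t i) < r) \<and>
        (\<forall>j<N + N. norm (join N (v t) l j) < s)"
      by (auto elim!: eventually_mono)
    have "((\<lambda>t. \<Sum>i<N. v t i * H i (join N (v t) l)) \<longlongrightarrow> (\<Sum>i<N. 0)) F"
    proof (rule tendsto_sum)
      fix i assume i: "i \<in> {..<N}"
      have "((\<lambda>t. norm (v t i) * B i) \<longlongrightarrow> norm (l i - l i) * B i) F"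
        unfolding v_def using \<gamma> i by (intro tendsto_intros) auto
      then have "((\<lambda>t. norm (v t i) * B i) \<longlongrightarrow> 0) F" by simp
      moreover have "\<forall>\<^sub>F t in F. norm (v t i * H i (join N (v t) l)) \<le> norm (v t i) * B i"
        using ev by eventually_elim (use i s in \<open>auto simp: norm_mult intro: mult_left_mono\<close>)
      ultimately show "((\<lambda>t. v t i * H i (join N (v t) l)) \<longlongrightarrow> 0) F"
        by (rule Lim_null_comparison[rotated])
    qed
    then have "((\<lambda>t. h l + (\<Sum>i<N. v t i * H i (join N (v t) l))) \<longlongrightarrow> h l + 0) F"
      by (intro tendsto_add tendsto_const) simp
    moreover have "\<forall>\<^sub>F t in F. h l + (\<Sum>i<N. v t i * H i (join N (v t) l)) = h (\<gamma> t)"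
      using ev
    proof eventually_elim
      case (elim t)
      have "h (\<lambda>i. l i + v t i) = h l + (\<Sum>i<N. v t i * H i (join N (v t) l))"
        using l elim by (intro r) auto
      then show ?case by (simp add: v_def)
    qed
    ultimately show ?thesis
      using Lim_transform_eventually by fastforce
  qed
  then show ?thesis
    using \<open>r > 0\<close> \<open>s > 0\<close> by (intro exI[of _ "min r s"]) auto
qed

text \<open>The derivative is read off from the increment formula
  \<open>g (x + v) = g x + \<Sum>i. v i * H i (v, x)\<close> at \<open>v = 0\<close>; no termwise differentiation is needed.\<close>

lemma analytic0_differentiable:
  assumes g: "analytic0 N g"
  shows "\<exists>D. (\<forall>i<N. analytic0 N (D i)) \<and> (\<forall>\<^sub>F x in germ0 N. \<forall>\<gamma> \<gamma>' t. \<gamma> t = x \<longrightarrow>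
    (\<forall>i<N. ((\<lambda>s. \<gamma> s i) has_field_derivative \<gamma>' i) (at t)) \<longrightarrow>
    ((\<lambda>s. g (\<gamma> s)) has_field_derivative (\<Sum>i<N. D i x * \<gamma>' i)) (at t))"
proof -
  obtain H r where H: "\<And>i. i < N \<Longrightarrow> analytic0 (N + N) (H i)" and "r > 0" and
    r: "\<And>x v. \<forall>i<N. norm (x i) < r \<Longrightarrow> \<forall>i<N. norm (v i) < r \<Longrightarrow>
      g (\<lambda>i. x i + v i) = g x + (\<Sum>i<N. v i * H i (join N v x))"
    using analytic0_difference[OF g] by blast
  have "\<exists>s>0. \<forall>i<N. \<forall>l \<gamma>. \<forall>F :: 'a filter. (\<forall>j<N + N. norm (l j) < s) \<longrightarrow>
    (\<forall>j<N + N. ((\<lambda>t. \<gamma> t j) \<longlongrightarrow> l j) F) \<longrightarrow> ((\<lambda>t. H i (\<gamma> t)) \<longlongrightarrow> H i l) F"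
    by (rule uniform_radius) (use analytic0_continuous[OF H] in \<open>auto 0 3 intro: less_le_trans\<close>)
  then obtain s where "s > 0" and
    s: "\<And>i l \<gamma> F. i < N \<Longrightarrow> \<forall>j<N + N. norm (l j) < s \<Longrightarrow>
      \<forall>j<N + N. ((\<lambda>t. \<gamma> t j) \<longlongrightarrow> l j) (F :: 'a filter) \<Longrightarrow> ((\<lambda>t. H i (\<gamma> t)) \<longlongrightarrow> H i l) F"
    by metis
  define D where "D i x = H i (join N (\<lambda>_. 0) x)" for i x
  have "analytic0 N (D i)" if "i < N" for i
    unfolding D_def by (rule analytic0_compose[OF H[OF that]]) (auto simp: join_def intro!: analytic0_if analytic0_coordinate)
  moreover have "((\<lambda>s. g (\<gamma> s)) has_field_derivative (\<Sum>i<N. D i (\<gamma> t) * \<gamma>' i)) (at t)"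
    if x: "\<forall>i<N. norm (\<gamma> t i) < min r s"
      and \<gamma>: "\<forall>i<N. ((\<lambda>s. \<gamma> s i) has_field_derivative \<gamma>' i) (at t)" for \<gamma> \<gamma>' t
    unfolding has_field_derivative_iff
  proof (rule Lim_transform_eventually)
    define v where "v u = (\<lambda>i. \<gamma> u i - \<gamma> t i)" for u
    have lim: "((\<lambda>u. \<gamma> u i) \<longlongrightarrow> \<gamma> t i) (at t)" if "i < N" for i
      using DERIV_isCont[of "\<lambda>s. \<gamma> s i"] \<gamma> that unfolding isCont_def by blast
    have v0: "((\<lambda>u. v u i) \<longlongrightarrow> 0) (at t)" if "i < N" for i
      unfolding v_def using lim[OF that] by (rule LIM_zero)
    \<comment> \<open>The increment formula divided by \<open>u - t\<close>: the quotients tend to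
      the velocity, and \<open>H i\<close> converges by continuity at increment zero.\<close>
    show "((\<lambda>u. \<Sum>i<N. H i (join N (v u) (\<gamma> t)) * (v u i / (u - t))) \<longlongrightarrow> (\<Sum>i<N. D i (\<gamma> t) * \<gamma>' i)) (at t)"
    proof (intro tendsto_sum tendsto_mult)
      fix i assume i: "i \<in> {..<N}"
      show "((\<lambda>u. v u i / (u - t)) \<longlongrightarrow> \<gamma>' i) (at t)"
        using \<gamma> i by (auto simp: v_def has_field_derivative_iff)
      show "((\<lambda>u. H i (join N (v u) (\<gamma> t))) \<longlongrightarrow> D i (\<gamma> t)) (at t)"
        unfolding D_def
      proof (rule s)
        show "\<forall>j<N + N. norm (join N (\<lambda>_. 0) (\<gamma> t) j) < s"
          using x \<open>s > 0\<close> by (auto simp: join_def)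
        show "\<forall>j<N + N. ((\<lambda>u. join N (v u) (\<gamma> t) j) \<longlongrightarrow> join N (\<lambda>_. 0) (\<gamma> t) j) (at t)"
          by (auto simp: join_def v0)
      qed (use i in auto)
    qed
    have "\<forall>\<^sub>F u in at t. \<forall>i<N. norm (v u i) < r"
      unfolding v_def by (rule eventually_norm_less) (use lim \<open>r > 0\<close> in auto)
    then show "\<forall>\<^sub>F u in at t. (\<Sum>i<N. H i (join N (v u) (\<gamma> t)) * (v u i / (u - t))) =
        (g (\<gamma> u) - g (\<gamma> t)) / (u - t)"
    proof eventually_elim
      case (elim u)
      have "g (\<lambda>i. \<gamma> t i + v u i) = g (\<gamma> t) + (\<Sum>i<N. v u i * H i (join N (v u) (\<gamma> t)))"
        using x elim by (intro r) auto
      then have "g (\<gamma> u) - g (\<gamma> t) = (\<Sum>i<N. v u i * H i (join N (v u) (\<gamma> t)))"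
        by (simp add: v_def)
      then show ?case by (simp add: sum_divide_distrib mult.commute)
    qed
  qed
  ultimately show ?thesis
    using \<open>r > 0\<close> \<open>s > 0\<close> unfolding eventually_germ0
    by (intro exI[of _ D]) (auto intro!: exI[of _ "min r s"])
qed

text \<open>The coordinate line through \<open>x\<close> in direction \<open>i\<close> is a curve
  whose velocity is the \<open>i\<close>-th unit vector.\<close>

lemma analytic0_pderiv_eq:
  assumes "\<forall>\<^sub>F x in germ0 N. \<forall>\<gamma> \<gamma>' t. \<gamma> t = x \<longrightarrow>
    (\<forall>i<N. ((\<lambda>s. \<gamma> s i) has_field_derivative \<gamma>' i) (at t)) \<longrightarrow>
    ((\<lambda>s. g (\<gamma> s)) has_field_derivative (\<Sum>i<N. D i x * \<gamma>' i)) (at t)"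
  shows "\<forall>\<^sub>F x in germ0 N. \<forall>i<N. pderiv g i x = D i x"
  using assms
proof eventually_elim
  case (elim x)
  have "pderiv g i x = D i x" if "i < N" for i
  proof -
    have "((\<lambda>s. g (x(i := s))) has_field_derivative (\<Sum>j<N. D j x * (if j = i then 1 else 0))) (at (x i))"
    proof (rule elim[rule_format])
      show "((\<lambda>s. (x(i := s)) j) has_field_derivative (if j = i then 1 else 0)) (at (x i))" for j
        by (auto intro!: derivative_eq_intros)
    qed simp
    then show ?thesis
      using that unfolding pderiv_def by (intro DERIV_imp_deriv) (simp add: mult_if_delta if_distrib cong: if_cong)
  qed
  then show ?case by blast
qed

lemma analytic0_pderiv:
  assumes "analytic0 N g" "i < N"
  shows "analytic0 N (pderiv g i)"
proof -
  obtain D where D: "\<forall>i<N. analytic0 N (D i)" "\<forall>\<^sub>F x in germ0 N. \<forall>\<gamma> \<gamma>' t. \<gamma> t = x \<longrightarrow>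
    (\<forall>i<N. ((\<lambda>s. \<gamma> s i) has_field_derivative \<gamma>' i) (at t)) \<longrightarrow>
    ((\<lambda>s. g (\<gamma> s)) has_field_derivative (\<Sum>i<N. D i x * \<gamma>' i)) (at t)"
    using analytic0_differentiable[OF assms(1)] by blast
  have "\<forall>\<^sub>F x in germ0 N. D i x = pderiv g i x"
    using analytic0_pderiv_eq[OF D(2)] by eventually_elim (use assms(2) in simp)
  with D(1) assms(2) show ?thesis
    by (auto intro: analytic0_cong)
qed

lemma analytic0_chain_rule:
  assumes "analytic0 N g"
  shows "\<forall>\<^sub>F x in germ0 N. \<forall>\<gamma> \<gamma>' t. \<gamma> t = x \<longrightarrow>
    (\<forall>i<N. ((\<lambda>s. \<gamma> s i) has_field_derivative \<gamma>' i) (at t)) \<longrightarrow>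
    ((\<lambda>s. g (\<gamma> s)) has_field_derivative (\<Sum>i<N. pderiv g i x * \<gamma>' i)) (at t)"
proof -
  obtain D where D: "\<forall>\<^sub>F x in germ0 N. \<forall>\<gamma> \<gamma>' t. \<gamma> t = x \<longrightarrow>
    (\<forall>i<N. ((\<lambda>s. \<gamma> s i) has_field_derivative \<gamma>' i) (at t)) \<longrightarrow>
    ((\<lambda>s. g (\<gamma> s)) has_field_derivative (\<Sum>i<N. D i x * \<gamma>' i)) (at t)"
    using analytic0_differentiable[OF assms(1)] by blast
  from D analytic0_pderiv_eq[OF D] show ?thesis
  proof eventually_elim
    case (elim x)
    have "(\<Sum>i<N. pderiv g i x * \<gamma>' i) = (\<Sum>i<N. D i x * \<gamma>' i)" for \<gamma>'
      by (intro sum.cong) (use elim(2) in auto)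
    with elim(1) show ?case by simp
  qed
qed

text \<open>Euler's relation: differentiate the homogeneity equation in \<open>t\<close> and
  multiply by \<open>t\<close> to restore the exponents.\<close>

lemma euler_identity:
  fixes g :: "(nat \<Rightarrow> 'k::{real_normed_field,banach}) \<Rightarrow> 'k"
  assumes g: "analytic0 N g"
    and hom: "\<forall>\<^sub>F x in germ0 N. \<forall>t. norm t \<le> 1 \<longrightarrow> g (\<lambda>i. t ^ w i * x i) = t ^ d * g x"
  shows "\<forall>\<^sub>F x in germ0 N. (\<Sum>i<N. pderiv g i x * (of_nat (w i) * x i)) = of_nat d * g x"
proof -
  obtain r1 where "r1 > 0" and chain: "\<forall>x. (\<forall>i<N. norm (x i) < r1) \<longrightarrow> (\<forall>\<gamma> \<gamma>' t. \<gamma> t = x \<longrightarrow>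
    (\<forall>i<N. ((\<lambda>s. \<gamma> s i) has_field_derivative \<gamma>' i) (at t)) \<longrightarrow>
    ((\<lambda>s. g (\<gamma> s)) has_field_derivative (\<Sum>i<N. pderiv g i x * \<gamma>' i)) (at t))"
    using analytic0_chain_rule[OF g] unfolding eventually_germ0 by (elim exE conjE)
  obtain r2 where "r2 > 0" and hom: "\<And>x t. \<forall>i<N. norm (x i) < r2 \<Longrightarrow> norm t \<le> 1 \<Longrightarrow>
      g (\<lambda>i. t ^ w i * x i) = t ^ d * g x"
    using hom unfolding eventually_germ0 by blast
  \<comment> \<open>The curve that meets \<open>y\<close> at \<open>t = 1/2\<close> starts from
    \<open>x i = 2 ^ w i * y i\<close>; since \<open>2 ^ W\<close> dominates every
    \<open>2 ^ w i\<close>, the radius \<open>r2 / 2 ^ W\<close> keeps \<open>x\<close> in the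
    domain of homogeneity.\<close>
  define W where "W = sum w {..<N}"
  define r where "r = min r1 (r2 / 2 ^ W)"
  have "(\<Sum>i<N. pderiv g i y * (of_nat (w i) * y i)) = of_nat d * g y"
    if y: "\<forall>i<N. norm (y i) < r" for y
  proof -
    txt \<open>Homogeneity is only available for \<open>norm t \<le> 1\<close>, so differentiate at the interior
      point \<open>t = 1/2\<close> of a curve that passes through \<open>y\<close> there.\<close>
    define t0 :: 'k where "t0 = 1 / 2"
    have t0: "t0 \<noteq> 0" "norm t0 < 1" by (auto simp: t0_def norm_divide)
    define x where "x i = y i * 2 ^ w i" for i
    define \<gamma> where "\<gamma> s = (\<lambda>i. s ^ w i * x i)" for s :: 'k
    have \<gamma>0: "\<gamma> t0 = y"
      by (auto simp: \<gamma>_def x_def t0_def power_divide)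
    have x: "\<forall>i<N. norm (x i) < r2"
    proof (intro allI impI)
      fix i assume i: "i < N"
      then have "w i \<le> W" unfolding W_def by (intro member_le_sum) auto
      then have "(2::real) ^ w i \<le> 2 ^ W" by (intro power_increasing) auto
      have "norm (x i) = norm (y i) * 2 ^ w i"
        by (simp add: x_def norm_mult norm_power)
      also have "\<dots> \<le> norm (y i) * 2 ^ W"
        using \<open>(2::real) ^ w i \<le> 2 ^ W\<close> by (intro mult_left_mono) auto
      also have "\<dots> < r2"
        using y i by (auto simp: r_def field_simps)
      finally show "norm (x i) < r2" .
    qed
    have "((\<lambda>s. g (\<gamma> s)) has_field_derivative
        (\<Sum>i<N. pderiv g i y * (of_nat (w i) * t0 ^ (w i - 1) * x i))) (at t0)"
    proof (rule chain[rule_format, of y \<gamma> t0])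
      show "((\<lambda>s. \<gamma> s i) has_field_derivative of_nat (w i) * t0 ^ (w i - 1) * x i) (at t0)" for i
        unfolding \<gamma>_def by (auto intro!: derivative_eq_intros)
    qed (use y \<gamma>0 in \<open>auto simp: r_def\<close>)
    moreover have "((\<lambda>s. g (\<gamma> s)) has_field_derivative of_nat d * t0 ^ (d - 1) * g x) (at t0)"
    proof (rule has_field_derivative_transform_within_open)
      show "((\<lambda>s. s ^ d * g x) has_field_derivative of_nat d * t0 ^ (d - 1) * g x) (at t0)"
        by (auto intro!: derivative_eq_intros)
      show "s ^ d * g x = g (\<gamma> s)" if "s \<in> ball 0 1" for s
        unfolding \<gamma>_def using that by (subst hom[OF x]) auto
    qed (use t0 in auto)
    ultimately have eq: "(\<Sum>i<N. pderiv g i y * (of_nat (w i) * t0 ^ (w i - 1) * x i)) = of_nat d * t0 ^ (d - 1) * g x"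
      by (rule DERIV_unique)
    \<comment> \<open>For \<open>k = 0\<close> the truncated \<open>k - 1\<close> is harmless
      because of the factor \<open>of_nat k\<close>.\<close>
    have pw: "of_nat k * t0 ^ (k - 1) * t0 = of_nat k * t0 ^ k" for k
      by (cases k) auto
    have "(\<Sum>i<N. pderiv g i y * (of_nat (w i) * y i)) =
        (\<Sum>i<N. pderiv g i y * (of_nat (w i) * t0 ^ (w i - 1) * x i)) * t0"
      unfolding sum_distrib_right
    proof (rule sum.cong)
      fix i
      have "of_nat (w i) * y i = of_nat (w i) * t0 ^ w i * x i"
        using fun_cong[OF \<gamma>0, of i] by (auto simp: \<gamma>_def mult_ac)
      also have "\<dots> = of_nat (w i) * t0 ^ (w i - 1) * x i * t0"
        by (simp flip: pw)
      finally show "pderiv g i y * (of_nat (w i) * y i) = pderiv g i y * (of_nat (w i) * t0 ^ (w i - 1) * x i) * t0"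
        by (simp only: mult.assoc)
    qed simp
    also have "\<dots> = of_nat d * t0 ^ (d - 1) * t0 * g x"
      unfolding eq by (simp add: mult_ac)
    also have "\<dots> = of_nat d * (t0 ^ d * g x)"
      unfolding pw by (simp add: mult_ac)
    also have "t0 ^ d * g x = g (\<gamma> t0)"
      unfolding \<gamma>_def using t0 by (subst hom[OF x]) auto
    finally show ?thesis by (simp add: \<gamma>0)
  qed
  moreover have "r > 0" using \<open>r1 > 0\<close> \<open>r2 > 0\<close> by (simp add: r_def)
  ultimately show ?thesis unfolding eventually_germ0 by blast
qed

section \<open>The Euler field of a weighted-homogeneous unfolding\<close>

text \<open>The ideal generated by the components of \<open>F\<close> in the ring of the source: the
  coefficients \<open>a i\<close> are functions on the source and need not factor through
  \<open>F\<close>.\<close>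

definition in_ideal :: "nat \<Rightarrow> nat \<Rightarrow> ((nat \<Rightarrow> 'k::{real_normed_field,banach}) \<Rightarrow> (nat \<Rightarrow> 'k))
    \<Rightarrow> ((nat \<Rightarrow> 'k) \<Rightarrow> 'k) \<Rightarrow> bool" where
  "in_ideal N P F g \<longleftrightarrow> (\<exists>a. (\<forall>i<P. analytic0 N (a i)) \<and>
     (\<forall>\<^sub>F y in germ0 N. g y = (\<Sum>i<P. F y i * a i y)))"

lemma in_ideal_generator: "i < P \<Longrightarrow> in_ideal N P F (\<lambda>y. F y i)"
  unfolding in_ideal_def
  by (intro exI[of _ "\<lambda>j _. if j = i then 1 else 0"])
    (auto simp: if_distrib cong: if_cong)

lemma in_ideal_0: "in_ideal N P F (\<lambda>_. 0)"
  unfolding in_ideal_def by (intro exI[of _ "\<lambda>_ _. 0"]) auto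

lemma in_ideal_add:
  assumes "in_ideal N P F g" "in_ideal N P F h"
  shows "in_ideal N P F (\<lambda>y. g y + h y)"
proof -
  obtain a b where "\<forall>i<P. analytic0 N (a i)" "\<forall>\<^sub>F y in germ0 N. g y = (\<Sum>i<P. F y i * a i y)"
    "\<forall>i<P. analytic0 N (b i)" "\<forall>\<^sub>F y in germ0 N. h y = (\<Sum>i<P. F y i * b i y)"
    using assms unfolding in_ideal_def by auto
  moreover from this(2,4) have "\<forall>\<^sub>F y in germ0 N. g y + h y = (\<Sum>i<P. F y i * (a i y + b i y))"
    by eventually_elim (simp add: distrib_left sum.distrib)
  ultimately show ?thesis
    unfolding in_ideal_def by (intro exI[of _ "\<lambda>i y. a i y + b i y"]) (auto intro: analytic0_add)
qed

lemma in_ideal_mult: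
  assumes "in_ideal N P F g" "analytic0 N h"
  shows "in_ideal N P F (\<lambda>y. g y * h y)"
proof -
  obtain a where "\<forall>i<P. analytic0 N (a i)" "\<forall>\<^sub>F y in germ0 N. g y = (\<Sum>i<P. F y i * a i y)"
    using assms unfolding in_ideal_def by auto
  moreover from this(2) have "\<forall>\<^sub>F y in germ0 N. g y * h y = (\<Sum>i<P. F y i * (a i y * h y))"
    by eventually_elim (simp add: sum_distrib_right mult.assoc)
  ultimately show ?thesis
    unfolding in_ideal_def using assms(2)
    by (intro exI[of _ "\<lambda>i y. a i y * h y"]) (auto intro: analytic0_mult)
qed

lemma in_ideal_diff:
  "in_ideal N P F g \<Longrightarrow> in_ideal N P F h \<Longrightarrow> in_ideal N P F (\<lambda>y. g y - h y)"
  using in_ideal_add[of N P F g "\<lambda>y. h y * (- 1)"] in_ideal_mult[of N P F h "\<lambda>_. - 1"] by simp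

lemma in_ideal_sum:
  "(\<And>k. k \<in> A \<Longrightarrow> in_ideal N P F (g k)) \<Longrightarrow> in_ideal N P F (\<lambda>y. \<Sum>k\<in>A. g k y)"
  by (induction A rule: infinite_finite_induct) (auto intro: in_ideal_add in_ideal_0)

lemma in_ideal_cong:
  assumes "in_ideal N P F g" "\<forall>\<^sub>F y in germ0 N. h y = g y"
  shows "in_ideal N P F h"
proof -
  obtain a where "\<forall>i<P. analytic0 N (a i)" "\<forall>\<^sub>F y in germ0 N. g y = (\<Sum>i<P. F y i * a i y)"
    using assms unfolding in_ideal_def by auto
  moreover from this(2) assms(2) have "\<forall>\<^sub>F y in germ0 N. h y = (\<Sum>i<P. F y i * a i y)"
    by eventually_elim simp
  ultimately show ?thesis
    unfolding in_ideal_def by blast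
qed

section \<open>Liftable fields from stability\<close>

lemma vf_eq_iff: "vf_eq N P \<xi> \<zeta> \<longleftrightarrow> (\<forall>\<^sub>F x in germ0 N. \<forall>j<P. \<xi> x j = \<zeta> x j)"
proof -
  have "(\<forall>\<^sub>F x in germ0 N. \<forall>j\<in>{..<P}. \<xi> x j = \<zeta> x j) \<longleftrightarrow>
      (\<forall>j\<in>{..<P}. \<forall>\<^sub>F x in germ0 N. \<xi> x j = \<zeta> x j)"
    by (rule eventually_ball_finite_distrib) simp
  then show ?thesis
    by (simp add: vf_eq_def germ_eq_iff Ball_def)
qed

text \<open>The differential is linear over functions on the source; the multipliers
  \<open>h a\<close> are not differentiated.\<close>

lemma dmap_diff_sum:
  "dmap N F (\<lambda>y i. \<xi> y i - (\<Sum>a\<in>T. h a y * \<eta> a y i)) y j =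
    dmap N F \<xi> y j - (\<Sum>a\<in>T. h a y * dmap N F (\<eta> a) y j)"
proof -
  have "(\<Sum>i<N. D i * (\<Sum>a\<in>T. h a y * \<eta> a y i)) = (\<Sum>a\<in>T. h a y * (\<Sum>i<N. D i * \<eta> a y i))" for D
    unfolding sum_distrib_left by (subst sum.swap) (simp add: mult_ac)
  then show ?thesis
    by (simp add: dmap_def right_diff_distrib sum_subtractf)
qed

text \<open>Stability writes every error term \<open>V a\<close> as \<open>dF(\<xi> a) + \<zeta> a \<circ> F\<close>; multiplying by functions
  pulled back from the target keeps this form, so such multiples can be absorbed into the lift.\<close>

lemma stable_liftable_correction:
  assumes stable: "stable N P F" and T: "finite T"
    and \<xi>0: "vf N N \<xi>0" and V: "\<And>a. a \<in> T \<Longrightarrow> vf N P (V a)"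
    and b: "\<And>a. a \<in> T \<Longrightarrow> analytic0 N (\<lambda>y. b a (F y))"
    and eq: "\<forall>\<^sub>F y in germ0 N. \<forall>j<P. dmap N F \<xi>0 y j = \<eta>0 (F y) j + (\<Sum>a\<in>T. b a (F y) * V a y j)"
  shows "\<exists>\<zeta>. (\<forall>a\<in>T. vf P P (\<zeta> a)) \<and> liftable N P F (\<lambda>Y j. \<eta>0 Y j + (\<Sum>a\<in>T. b a Y * \<zeta> a Y j))"
proof -
  have "\<forall>a\<in>T. \<exists>\<xi>\<zeta>. vf N N (fst \<xi>\<zeta>) \<and> vf P P (snd \<xi>\<zeta>) \<and>
      vf_eq N P (V a) (\<lambda>y j. dmap N F (fst \<xi>\<zeta>) y j + snd \<xi>\<zeta> (F y) j)"
    using stable V unfolding stable_def by simp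
  from bchoice[OF this] obtain \<xi>\<zeta> where \<xi>\<zeta>: "\<forall>a\<in>T. vf N N (fst (\<xi>\<zeta> a)) \<and> vf P P (snd (\<xi>\<zeta> a)) \<and>
      vf_eq N P (V a) (\<lambda>y j. dmap N F (fst (\<xi>\<zeta> a)) y j + snd (\<xi>\<zeta> a) (F y) j)" ..
  define \<xi> \<zeta> where "\<xi> a = fst (\<xi>\<zeta> a)" and "\<zeta> a = snd (\<xi>\<zeta> a)" for a
  have \<xi>: "\<And>a. a \<in> T \<Longrightarrow> vf N N (\<xi> a)" and \<zeta>: "\<And>a. a \<in> T \<Longrightarrow> vf P P (\<zeta> a)" and
    V_eq: "\<And>a. a \<in> T \<Longrightarrow> \<forall>\<^sub>F y in germ0 N. \<forall>j<P. V a y j = dmap N F (\<xi> a) y j + \<zeta> a (F y) j"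
    using \<xi>\<zeta> by (auto simp: \<xi>_def \<zeta>_def vf_eq_iff)
  \<comment> \<open>Once each \<open>V a\<close> is replaced by its decomposition, the
    \<open>dF\<close>-parts of the error are moved into the source field and the parts pulled back
    from the target stay with \<open>\<eta>0\<close>.\<close>
  define \<xi>1 where "\<xi>1 = (\<lambda>y i. \<xi>0 y i - (\<Sum>a\<in>T. b a (F y) * \<xi> a y i))"
  have "vf N N \<xi>1"
    using \<xi>0 \<xi> unfolding vf_def \<xi>1_def
    by (auto intro!: analytic0_diff analytic0_sum analytic0_mult b)
  moreover have "vf_eq N P (\<lambda>y j. \<eta>0 (F y) j + (\<Sum>a\<in>T. b a (F y) * \<zeta> a (F y) j)) (dmap N F \<xi>1)"
  proof -
    have "\<forall>\<^sub>F y in germ0 N. \<forall>a\<in>T. \<forall>j<P. V a y j = dmap N F (\<xi> a) y j + \<zeta> a (F y) j"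
      by (rule eventually_ball_finite[OF T]) (use V_eq in auto)
    with eq show ?thesis
      unfolding vf_eq_iff
    proof eventually_elim
      case (elim y)
      show ?case
      proof (intro allI impI)
        fix j assume j: "j < P"
        have "(\<Sum>a\<in>T. b a (F y) * V a y j) =
            (\<Sum>a\<in>T. b a (F y) * dmap N F (\<xi> a) y j) + (\<Sum>a\<in>T. b a (F y) * \<zeta> a (F y) j)"
          unfolding sum.distrib[symmetric] by (rule sum.cong) (use elim(2) j in \<open>auto simp: distrib_left\<close>)
        then show "\<eta>0 (F y) j + (\<Sum>a\<in>T. b a (F y) * \<zeta> a (F y) j) = dmap N F \<xi>1 y j"
          using elim(1) j unfolding \<xi>1_def dmap_diff_sum by simp
      qed
    qed
  qed
  ultimately have "liftable N P F (\<lambda>Y j. \<eta>0 Y j + (\<Sum>a\<in>T. b a Y * \<zeta> a Y j))"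
    unfolding liftable_def by blast
  with \<zeta> show ?thesis by blast
qed

lemma monom_weighted:
  "monom N (\<lambda>i. t ^ w i * x i) \<alpha> = t ^ (\<Sum>i<N. w i * \<alpha> i) * monom N x \<alpha>"
  by (simp add: monom_mult) (simp add: monom_def power_sum power_mult)

lemma eventually_all_less:
  assumes "\<And>j. j < P \<Longrightarrow> \<forall>\<^sub>F x in germ0 N. Q j x"
  shows "\<forall>\<^sub>F x in germ0 N. \<forall>j<(P::nat). Q j x"
proof -
  have "\<forall>\<^sub>F x in germ0 N. \<forall>j\<in>{..<P}. Q j x"
    by (rule eventually_ball_finite) (use assms in auto)
  then show ?thesis by (simp add: Ball_def)
qed

section \<open>The weighted unfolding and its defect from homogeneity\<close>

locale weighted_unfolding =
  fixes f :: "(nat \<Rightarrow> 'k::{real_normed_field,banach}) \<Rightarrow> (nat \<Rightarrow> 'k)"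
    and n p m :: nat
    and \<alpha> :: "nat \<Rightarrow> nat \<Rightarrow> nat" and jk :: "nat \<Rightarrow> nat"
    and q :: "nat \<Rightarrow> nat \<Rightarrow> (nat \<Rightarrow> 'k) \<Rightarrow> 'k"
    and w d :: "nat \<Rightarrow> nat"
  assumes f_analytic: "vf n p f"
    and f_zero: "\<forall>j<p. f (\<lambda>_. 0) j = 0"
    and alpha_idx: "\<forall>k<m. \<alpha> k \<in> multi_idx n"
    and f_homogeneous: "\<forall>\<^sub>F x in germ0 n. \<forall>t. norm t \<le> 1 \<longrightarrow>
        (\<forall>j<p. f (\<lambda>i. t ^ w i * x i) j = t ^ d j * f x j)"
    and q_analytic: "\<forall>k<m. \<forall>s<m. analytic0 (p + m) (q k s)"
    and q_zero: "\<forall>k<m. \<forall>s<m. q k s (\<lambda>_. 0) = 0"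
begin

abbreviation F where "F \<equiv> unf n p m f \<alpha> jk q"

text \<open>The trivial unfolding \<open>(x, \<lambda>) \<mapsto> (f(x), \<lambda>)\<close>, the
  point at which the \<open>q k s\<close> are evaluated.\<close>

definition \<Phi> :: "(nat \<Rightarrow> 'k) \<Rightarrow> nat \<Rightarrow> 'k" where
  "\<Phi> y = join p (f (takep n y)) (dropp n y)"

text \<open>The number \<open>d_(p+k)\<close>.\<close>

definition deg :: "nat \<Rightarrow> nat" where
  "deg k = (\<Sum>i<n. w i * \<alpha> k i)"

text \<open>Giving \<open>\<lambda>\<^sub>k\<close> the (possibly negative) weight \<open>c k\<close> makes \<open>f + \<Sum>k. \<lambda>\<^sub>k fbar\<^sup>k\<close> weighted
  homogeneous; good weights say exactly that \<open>c k \<noteq> 0\<close>.\<close>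

definition c :: "nat \<Rightarrow> 'k" where
  "c k = of_nat (d (jk k)) - of_nat (deg k)"

text \<open>Weights of the target coordinates: \<open>\<delta> i * Y i\<close> are the components of
  the target Euler field.\<close>

definition \<delta> :: "nat \<Rightarrow> 'k" where
  "\<delta> i = (if i < p then of_nat (d i) else c (i - p))"

definition euler :: "(nat \<Rightarrow> 'k) \<Rightarrow> nat \<Rightarrow> 'k" where
  "euler y i = (if i < n then of_nat (w i) else c (i - n)) * y i"

text \<open>The function \<open>r_ks\<close> of the overview. With \<open>E\<close> the target Euler
  field it is \<open>E(q k s) + (c s - c k) * q k s\<close>, which measures how far
  \<open>\<lambda>_s * q k s\<close> is from having the weight \<open>c k\<close> of
  \<open>\<lambda>_k\<close>; it vanishes identically when \<open>q k s\<close> has weight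
  \<open>c k - c s\<close>.\<close>

definition defect :: "nat \<Rightarrow> nat \<Rightarrow> (nat \<Rightarrow> 'k) \<Rightarrow> 'k" where
  "defect k s Y = (c s - c k) * q k s Y + (\<Sum>i<p + m. pderiv (q k s) i Y * (\<delta> i * Y i))"

lemma F_less: "j < p \<Longrightarrow> F y j = f (takep n y) j + (\<Sum>k<m. (dropp n y k +
    (\<Sum>s<m. dropp n y s * q k s (\<Phi> y))) * fbar n \<alpha> jk k (takep n y) j)"
  by (simp add: unf_def \<Phi>_def)

lemma F_ge: "F y (p + k) = dropp n y k"
  by (simp add: unf_def)

lemma analytic0_takep: "analytic0 (n + m) (\<lambda>y. takep n y i)"
  unfolding takep_def by (auto intro!: analytic0_if analytic0_coordinate)

lemma analytic0_dropp: "k < m \<Longrightarrow> analytic0 (n + m) (\<lambda>y. dropp n y k)"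
  unfolding dropp_def by (auto intro!: analytic0_coordinate)

lemma analytic0_f_takep: "j < p \<Longrightarrow> analytic0 (n + m) (\<lambda>y. f (takep n y) j)"
  by (rule analytic0_compose[of n "\<lambda>x. f x j"])
    (use f_analytic in \<open>auto simp: vf_def takep_def intro!: analytic0_if analytic0_coordinate\<close>)

lemma analytic0_fbar: "k < m \<Longrightarrow> analytic0 (n + m) (\<lambda>y. fbar n \<alpha> jk k (takep n y) j)"
  unfolding fbar_def
  by (intro analytic0_if analytic0_compose[OF analytic0_monom] analytic0_takep)
    (use alpha_idx in \<open>auto simp: takep_def\<close>)

lemma analytic0_\<Phi>: "i < p + m \<Longrightarrow> analytic0 (n + m) (\<lambda>y. \<Phi> y i)"
  unfolding \<Phi>_def join_def by (intro analytic0_if analytic0_f_takep analytic0_dropp) auto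

lemma \<Phi>_0: "i < p + m \<Longrightarrow> \<Phi> (\<lambda>_. 0) i = 0"
  using f_zero by (auto simp: \<Phi>_def join_def takep_def dropp_def)

lemma analytic0_comp_\<Phi>: "analytic0 (p + m) g \<Longrightarrow> analytic0 (n + m) (\<lambda>y. g (\<Phi> y))"
  by (rule analytic0_compose) (auto intro: analytic0_\<Phi> \<Phi>_0)

lemma F_analytic: "vf (n + m) (p + m) F"
  unfolding vf_def
proof (intro allI impI)
  fix j assume j: "j < p + m"
  show "analytic0 (n + m) (\<lambda>y. F y j)"
  proof (cases "j < p")
    case True
    have "analytic0 (n + m) (\<lambda>y. q k s (\<Phi> y))" if "k < m" "s < m" for k s
      using q_analytic that by (intro analytic0_comp_\<Phi>) auto
    then show ?thesis
      unfolding F_less[OF True]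
      by (intro analytic0_add analytic0_f_takep[OF True] analytic0_sum analytic0_mult
          analytic0_dropp analytic0_fbar) auto
  next
    case False
    then have "(\<lambda>y. F y j) = (\<lambda>y. dropp n y (j - p))"
      by (simp add: unf_def)
    then show ?thesis
      using j False by (simp add: analytic0_dropp)
  qed
qed

lemma euler_analytic: "vf (n + m) (n + m) euler"
  unfolding vf_def euler_def by (auto intro!: analytic0_mult analytic0_coordinate)

lemma filterlim_takep: "filterlim (takep n) (germ0 n) (germ0 (n + m) :: (nat \<Rightarrow> 'k) filter)"
  by (rule filterlim_germ0_analytic) (auto intro: analytic0_takep, simp add: takep_def)

lemma filterlim_\<Phi>: "filterlim \<Phi> (germ0 (p + m)) (germ0 (n + m))"
  by (rule filterlim_germ0_analytic) (auto intro: analytic0_\<Phi> \<Phi>_0)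

text \<open>The straight line has the Euler field as velocity at \<open>t = 0\<close>, which is all
  that the chain rule sees; Euler's identity then evaluates the derivative.\<close>

lemma derivative_along_euler:
  assumes g: "analytic0 n g"
    and hom: "\<forall>\<^sub>F x in germ0 n. \<forall>t. norm t \<le> 1 \<longrightarrow> g (\<lambda>i. t ^ w i * x i) = t ^ e * g x"
  shows "\<forall>\<^sub>F y in germ0 (n + m). ((\<lambda>t. g (takep n (\<lambda>i. y i + t * euler y i)))
    has_field_derivative of_nat e * g (takep n y)) (at 0)"
proof -
  \<comment> \<open>Quantifying over all \<open>y\<close> above \<open>x\<close> gives a property of
    \<open>x\<close> alone, which can be pulled back along \<open>takep n\<close>.\<close>
  have "\<forall>\<^sub>F x in germ0 n. \<forall>y. takep n y = x \<longrightarrow>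
    ((\<lambda>t. g (takep n (\<lambda>i. y i + t * euler y i))) has_field_derivative of_nat e * g x) (at 0)"
    using analytic0_chain_rule[OF g] euler_identity[OF g hom]
  proof eventually_elim
    case (elim x)
    show ?case
    proof (intro allI impI)
      fix y assume y: "takep n y = x"
      have "((\<lambda>t. g (takep n (\<lambda>i. y i + t * euler y i))) has_field_derivative
          (\<Sum>i<n. pderiv g i x * (of_nat (w i) * x i))) (at 0)"
      proof (rule elim(1)[rule_format])
        show "((\<lambda>t. takep n (\<lambda>i. y i + t * euler y i) i) has_field_derivative of_nat (w i) * x i) (at 0)"
          if "i < n" for i
          using that by (auto simp: takep_def euler_def simp flip: y intro!: derivative_eq_intros)
      qed (simp add: y)
      then show "((\<lambda>t. g (takep n (\<lambda>i. y i + t * euler y i))) has_field_derivative of_nat e * g x) (at 0)"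
        unfolding elim(2) .
    qed
  qed
  from eventually_compose_filterlim[OF this filterlim_takep] show ?thesis
    by (auto elim: eventually_mono)
qed

text \<open>Both sides are the derivative at \<open>t = 0\<close> of a component of \<open>F\<close>
  along \<open>y + t * euler y\<close>: the left by the chain rule for \<open>F\<close>, the right
  by differentiating the formula for \<open>F\<close> term by term. Uniqueness of derivatives
  equates them.\<close>

lemma dmap_euler:
  "\<forall>\<^sub>F y in germ0 (n + m). \<forall>j<p + m. dmap (n + m) F euler y j = \<delta> j * F y j +
    (if j < p then \<Sum>k<m. (\<Sum>s<m. dropp n y s * defect k s (\<Phi> y)) * fbar n \<alpha> jk k (takep n y) j else 0)"
proof -
  define \<gamma> where "\<gamma> y t = (\<lambda>i. y i + t * euler y i)" for y t
  have \<gamma>0: "\<gamma> y 0 = y" for y by (simp add: \<gamma>_def)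
  have "\<forall>\<^sub>F y in germ0 (n + m). \<forall>j<p + m.
      ((\<lambda>t. F (\<gamma> y t) j) has_field_derivative dmap (n + m) F euler y j) (at 0)"
  proof (rule eventually_all_less)
    fix j assume "j < p + m"
    then have "analytic0 (n + m) (\<lambda>y. F y j)"
      using F_analytic by (auto simp: vf_def)
    from analytic0_chain_rule[OF this]
    show "\<forall>\<^sub>F y in germ0 (n + m). ((\<lambda>t. F (\<gamma> y t) j) has_field_derivative dmap (n + m) F euler y j) (at 0)"
    proof eventually_elim
      case (elim y)
      show ?case
        unfolding dmap_def
        by (rule elim[rule_format, of "\<gamma> y" 0 "euler y"]) (auto simp: \<gamma>_def intro!: derivative_eq_intros)
    qed
  qed
  moreover have "\<forall>\<^sub>F y in germ0 (n + m). \<forall>j<p.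
      ((\<lambda>t. f (takep n (\<gamma> y t)) j) has_field_derivative of_nat (d j) * f (takep n y) j) (at 0)"
  proof (rule eventually_all_less)
    fix j assume j: "j < p"
    show "\<forall>\<^sub>F y in germ0 (n + m).
      ((\<lambda>t. f (takep n (\<gamma> y t)) j) has_field_derivative of_nat (d j) * f (takep n y) j) (at 0)"
      unfolding \<gamma>_def
    proof (rule derivative_along_euler)
      show "\<forall>\<^sub>F x in germ0 n. \<forall>t. norm t \<le> 1 \<longrightarrow> f (\<lambda>i. t ^ w i * x i) j = t ^ d j * f x j"
        using f_homogeneous by eventually_elim (use j in auto)
    qed (use f_analytic j in \<open>auto simp: vf_def\<close>)
  qed
  moreover have "\<forall>\<^sub>F y in germ0 (n + m). \<forall>k<m.
      ((\<lambda>t. monom n (takep n (\<gamma> y t)) (\<alpha> k)) has_field_derivative of_nat (deg k) * monom n (takep n y) (\<alpha> k)) (at 0)"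
    unfolding \<gamma>_def
    by (intro eventually_all_less derivative_along_euler analytic0_monom)
      (use alpha_idx in \<open>auto simp: monom_weighted deg_def\<close>)
  moreover have "\<forall>\<^sub>F y in germ0 (n + m). \<forall>k<m. \<forall>s<m. \<forall>\<phi> \<phi>' t. \<phi> t = \<Phi> y \<longrightarrow>
    (\<forall>i<p + m. ((\<lambda>s. \<phi> s i) has_field_derivative \<phi>' i) (at t)) \<longrightarrow>
    ((\<lambda>t. q k s (\<phi> t)) has_field_derivative (\<Sum>i<p + m. pderiv (q k s) i (\<Phi> y) * \<phi>' i)) (at t)"
  proof (rule eventually_all_less, rule eventually_all_less)
    fix k s assume "k < m" "s < m"
    then have "analytic0 (p + m) (q k s)" using q_analytic by auto
    from eventually_compose_filterlim[OF analytic0_chain_rule[OF this] filterlim_\<Phi>]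
    show "\<forall>\<^sub>F y in germ0 (n + m). \<forall>\<phi> \<phi>' t. \<phi> t = \<Phi> y \<longrightarrow>
      (\<forall>i<p + m. ((\<lambda>s. \<phi> s i) has_field_derivative \<phi>' i) (at t)) \<longrightarrow>
      ((\<lambda>t. q k s (\<phi> t)) has_field_derivative (\<Sum>i<p + m. pderiv (q k s) i (\<Phi> y) * \<phi>' i)) (at t)" .
  qed
  ultimately show ?thesis
  proof eventually_elim
    case (elim y)
    let ?L = "dropp n y" and ?x = "takep n y"
    have L: "((\<lambda>t. dropp n (\<gamma> y t) k) has_field_derivative c k * ?L k) (at 0)" for k
      by (auto simp: dropp_def \<gamma>_def euler_def intro!: derivative_eq_intros)
    have q: "((\<lambda>t. q k s (\<Phi> (\<gamma> y t))) has_field_derivative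
        (\<Sum>i<p + m. pderiv (q k s) i (\<Phi> y) * (\<delta> i * \<Phi> y i))) (at 0)" if "k < m" "s < m" for k s
    proof (rule elim(4)[rule_format])
      show "((\<lambda>t. \<Phi> (\<gamma> y t) i) has_field_derivative \<delta> i * \<Phi> y i) (at 0)" if "i < p + m" for i
        using that elim(2) L by (auto simp: \<Phi>_def join_def \<delta>_def)
    qed (use that in \<open>auto simp: \<gamma>0\<close>)
    show ?case
    proof (intro allI impI)
      fix j assume j: "j < p + m"
      show "dmap (n + m) F euler y j = \<delta> j * F y j +
        (if j < p then \<Sum>k<m. (\<Sum>s<m. ?L s * defect k s (\<Phi> y)) * fbar n \<alpha> jk k ?x j else 0)"
      proof (cases "j < p")
        case False
        have "((\<lambda>t. F (\<gamma> y t) j) has_field_derivative c (j - p) * ?L (j - p)) (at 0)"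
          using L[of "j - p"] F_ge[of _ "j - p"] False by simp
        with elim(1) j have "dmap (n + m) F euler y j = c (j - p) * ?L (j - p)"
          using DERIV_unique by blast
        then show ?thesis
          using F_ge[of y "j - p"] False by (simp add: \<delta>_def)
      next
        case True
        define b where "b k = fbar n \<alpha> jk k ?x j" for k
        define Q where "Q k s = (\<Sum>i<p + m. pderiv (q k s) i (\<Phi> y) * (\<delta> i * \<Phi> y i))" for k s
        \<comment> \<open>\<open>G k\<close> is the coefficient of \<open>fbar\<close> number
          \<open>k\<close> in \<open>F\<close>, and \<open>G' k\<close> is its derivative along the
          Euler field.\<close>
        define G where "G k = ?L k + (\<Sum>s<m. ?L s * q k s (\<Phi> y))" for k
        define G' where "G' k = c k * ?L k + (\<Sum>s<m. c s * ?L s * q k s (\<Phi> y) + Q k s * ?L s)" for k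
        have b: "((\<lambda>t. fbar n \<alpha> jk k (takep n (\<gamma> y t)) j) has_field_derivative of_nat (deg k) * b k) (at 0)"
          if "k < m" for k
          using elim(3) that by (auto simp: fbar_def b_def)
        have G: "((\<lambda>t. dropp n (\<gamma> y t) k + (\<Sum>s<m. dropp n (\<gamma> y t) s * q k s (\<Phi> (\<gamma> y t))))
            has_field_derivative G' k) (at 0)" if "k < m" for k
          unfolding G'_def
          using DERIV_mult'[OF L q[OF that]]
          by (intro DERIV_add L DERIV_sum) (auto simp: Q_def \<gamma>0 mult_ac add_ac)
        have "((\<lambda>t. F (\<gamma> y t) j) has_field_derivative
            of_nat (d j) * f ?x j + (\<Sum>k<m. G k * (of_nat (deg k) * b k) + G' k * b k)) (at 0)"
          unfolding F_less[OF True]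
        proof (intro DERIV_add DERIV_sum)
          show "((\<lambda>t. f (takep n (\<gamma> y t)) j) has_field_derivative of_nat (d j) * f ?x j) (at 0)"
            using elim(2) True by blast
          fix k assume "k \<in> {..<m}"
          then have k: "k < m" by simp
          show "((\<lambda>t. (dropp n (\<gamma> y t) k + (\<Sum>s<m. dropp n (\<gamma> y t) s * q k s (\<Phi> (\<gamma> y t)))) *
              fbar n \<alpha> jk k (takep n (\<gamma> y t)) j) has_field_derivative
              G k * (of_nat (deg k) * b k) + G' k * b k) (at 0)"
            using DERIV_mult'[OF G[OF k] b[OF k]] by (simp add: \<gamma>0 G_def b_def)
        qed
        with elim(1) j have "dmap (n + m) F euler y j =
            of_nat (d j) * f ?x j + (\<Sum>k<m. G k * (of_nat (deg k) * b k) + G' k * b k)"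
          using DERIV_unique by blast
        also have "(\<Sum>k<m. G k * (of_nat (deg k) * b k) + G' k * b k) =
            (\<Sum>k<m. of_nat (d j) * (G k * b k) + (\<Sum>s<m. ?L s * defect k s (\<Phi> y)) * b k)"
        proof (rule sum.cong[OF refl])
          fix k
          show "G k * (of_nat (deg k) * b k) + G' k * b k =
              of_nat (d j) * (G k * b k) + (\<Sum>s<m. ?L s * defect k s (\<Phi> y)) * b k"
          \<comment> \<open>Outside component \<open>jk k\<close> the monomial field vanishes. In
            that component \<open>deg k = d j - c k\<close>, so beyond the part of weight
            \<open>d j\<close> there remains \<open>(G' k - c k * G k) * b k\<close>, and the linear
            term of \<open>G k\<close> in \<open>\<lambda>_k\<close> cancels.\<close>
          proof (cases "j = jk k")
            case False
            then show ?thesis by (simp add: b_def fbar_def)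
          next
            case True
            have "(\<Sum>s<m. ?L s * defect k s (\<Phi> y)) = G' k - c k * G k"
              unfolding defect_def G'_def G_def Q_def[symmetric]
              by (simp add: sum_distrib_left sum.distrib sum_subtractf algebra_simps)
            moreover have "of_nat (deg k) = of_nat (d j) - c k"
              by (simp add: c_def True)
            ultimately show ?thesis
              by (simp only:) (simp add: algebra_simps)
          qed
        qed
        also have "of_nat (d j) * f ?x j + \<dots> = \<delta> j * F y j +
            (\<Sum>k<m. (\<Sum>s<m. ?L s * defect k s (\<Phi> y)) * b k)"
          unfolding F_less[OF True] using True
          by (simp add: \<delta>_def sum.distrib sum_distrib_left distrib_left G_def b_def)
        finally show ?thesis
          using True by (simp add: b_def)
      qed
    qed
  qed
qed

text \<open>The parameters are themselves components of \<open>F\<close>, and \<open>f_i\<close>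
  differs from \<open>F_i\<close> by terms that each contain a parameter as a factor.\<close>

lemma \<Phi>_in_ideal:
  assumes "i < p + m"
  shows "in_ideal (n + m) (p + m) F (\<lambda>y. \<Phi> y i)"
proof -
  have L: "in_ideal (n + m) (p + m) F (\<lambda>y. dropp n y k)" if "k < m" for k
    using in_ideal_generator[of "p + k" "p + m" "n + m" F] that unfolding F_ge by simp
  show ?thesis
  proof (cases "i < p")
    case True
    have eq: "(\<lambda>y. \<Phi> y i) = (\<lambda>y. F y i - (\<Sum>k<m. (dropp n y k +
        (\<Sum>s<m. dropp n y s * q k s (\<Phi> y))) * fbar n \<alpha> jk k (takep n y) i))"
      using True by (simp add: F_less) (simp add: \<Phi>_def join_def)
    show ?thesis
      unfolding eq using assms q_analytic
      by (intro in_ideal_diff in_ideal_generator in_ideal_sum in_ideal_mult in_ideal_add L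
          analytic0_fbar analytic0_comp_\<Phi>) auto
  next
    case False
    then show ?thesis
      using L[of "i - p"] assms by (simp add: \<Phi>_def join_def)
  qed
qed

text \<open>Hadamard division writes \<open>q k s\<close>, which vanishes at the origin, as a
  combination of the \<open>Y_i\<close>; the derivative terms carry a factor \<open>Y_i\<close>
  already. Pulled back by \<open>\<Phi>\<close>, these factors become members of the ideal.\<close>

lemma defect_in_ideal:
  assumes "k < m" "s < m"
  shows "in_ideal (n + m) (p + m) F (\<lambda>y. defect k s (\<Phi> y))"
proof -
  have q: "analytic0 (p + m) (q k s)" using q_analytic assms by auto
  obtain H where H: "\<forall>i<p + m. analytic0 (p + m) (H i)"
    "\<forall>\<^sub>F Y in germ0 (p + m). q k s Y = q k s (\<lambda>_. 0) + (\<Sum>i<p + m. Y i * H i Y)"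
    using analytic0_hadamard[OF q] by blast
  have "\<forall>\<^sub>F y in germ0 (n + m). q k s (\<Phi> y) = (\<Sum>i<p + m. \<Phi> y i * H i (\<Phi> y))"
    using eventually_compose_filterlim[OF H(2) filterlim_\<Phi>] q_zero assms by simp
  moreover have "in_ideal (n + m) (p + m) F (\<lambda>y. \<Sum>i<p + m. \<Phi> y i * H i (\<Phi> y))"
    using H(1) by (intro in_ideal_sum in_ideal_mult \<Phi>_in_ideal analytic0_comp_\<Phi>) auto
  ultimately have "in_ideal (n + m) (p + m) F (\<lambda>y. q k s (\<Phi> y))"
    by (rule in_ideal_cong[rotated])
  then have "in_ideal (n + m) (p + m) F (\<lambda>y. q k s (\<Phi> y) * (c s - c k) +
      (\<Sum>i<p + m. \<Phi> y i * (\<delta> i * pderiv (q k s) i (\<Phi> y))))"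
    by (intro in_ideal_add in_ideal_sum in_ideal_mult \<Phi>_in_ideal analytic0_mult analytic0_const
        analytic0_comp_\<Phi>[OF analytic0_pderiv[OF q]]) auto
  then show ?thesis
    by (simp add: defect_def mult_ac)
qed

text \<open>Expanding the defects over the components of \<open>F\<close> brings the error into the
  form required by \<open>stable_liftable_correction\<close>; the multipliers are the generators
  \<open>\<Lambda>_s * Y_i\<close> of \<open>m_\<Lambda> m_(p+m)\<close>.\<close>

theorem stable_imp_substantial:
  assumes stable: "stable (n + m) (p + m) F" and good: "\<And>k. k < m \<Longrightarrow> deg k \<noteq> d (jk k)"
  shows "substantial n p m F"
proof -
  have "\<forall>ks\<in>{..<m} \<times> {..<m}. \<exists>a. (\<forall>i<p + m. analytic0 (n + m) (a i)) \<and>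
     (\<forall>\<^sub>F y in germ0 (n + m). defect (fst ks) (snd ks) (\<Phi> y) = (\<Sum>i<p + m. F y i * a i y))"
    using defect_in_ideal unfolding in_ideal_def by auto
  from bchoice[OF this] obtain A where A: "\<forall>ks\<in>{..<m} \<times> {..<m}. (\<forall>i<p + m. analytic0 (n + m) (A ks i)) \<and>
     (\<forall>\<^sub>F y in germ0 (n + m). defect (fst ks) (snd ks) (\<Phi> y) = (\<Sum>i<p + m. F y i * A ks i y))" ..
  define a where "a k s = A (k, s)" for k s
  have a: "\<And>k s i. k < m \<Longrightarrow> s < m \<Longrightarrow> i < p + m \<Longrightarrow> analytic0 (n + m) (a k s i)"
    "\<And>k s. k < m \<Longrightarrow> s < m \<Longrightarrow> \<forall>\<^sub>F y in germ0 (n + m). defect k s (\<Phi> y) = (\<Sum>i<p + m. F y i * a k s i y)"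
    using A unfolding a_def by auto
  define T where "T = {..<m} \<times> {..<p + m}"
  \<comment> \<open>\<open>V (s, i)\<close> collects, over all \<open>k\<close>, what multiplies
    \<open>F_(p+s) * F_i\<close> in the error. The parameter components are zero because the error
    has none there.\<close>
  define V where "V = (\<lambda>(s, i) y j. if j < p then \<Sum>k<m. a k s i y * fbar n \<alpha> jk k (takep n y) j else 0)"
  define b where "b = (\<lambda>(s, i) Y. Y (p + s) * Y i :: 'k)"
  have b: "analytic0 (n + m) (\<lambda>y. b t (F y))" if "t \<in> T" for t
    using F_analytic that by (auto simp: b_def T_def vf_def intro!: analytic0_mult)
  have V: "vf (n + m) (p + m) (V t)" if "t \<in> T" for t
    using that by (auto simp: V_def T_def vf_def intro!: analytic0_if analytic0_sum analytic0_mult analytic0_fbar a)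
  have "\<forall>\<^sub>F y in germ0 (n + m). \<forall>k<m. \<forall>s<m. defect k s (\<Phi> y) = (\<Sum>i<p + m. F y i * a k s i y)"
    by (intro eventually_all_less a)
  with dmap_euler have "\<forall>\<^sub>F y in germ0 (n + m). \<forall>j<p + m. dmap (n + m) F euler y j =
      (\<lambda>Y j. \<delta> j * Y j) (F y) j + (\<Sum>t\<in>T. b t (F y) * V t y j)"
  proof eventually_elim
    case (elim y)
    show ?case
    proof (intro allI impI)
      fix j assume j: "j < p + m"
      have "(\<Sum>t\<in>T. b t (F y) * V t y j) = (if j < p then
          \<Sum>k<m. (\<Sum>s<m. dropp n y s * defect k s (\<Phi> y)) * fbar n \<alpha> jk k (takep n y) j else 0)"
      proof (cases "j < p")
        case False
        then show ?thesis by (simp add: V_def split_beta)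
      next
        case True
        have "(\<Sum>t\<in>T. b t (F y) * V t y j) = (\<Sum>s<m. \<Sum>i<p + m. \<Sum>k<m.
            dropp n y s * (F y i * a k s i y) * fbar n \<alpha> jk k (takep n y) j)"
          using True unfolding T_def
          by (subst sum.cartesian_product')
            (simp add: b_def V_def F_ge sum_distrib_left mult_ac)
        also have "\<dots> = (\<Sum>s<m. \<Sum>k<m. \<Sum>i<p + m.
            dropp n y s * (F y i * a k s i y) * fbar n \<alpha> jk k (takep n y) j)"
          by (intro sum.cong refl sum.swap)
        also have "\<dots> = (\<Sum>k<m. \<Sum>s<m. \<Sum>i<p + m.
            dropp n y s * (F y i * a k s i y) * fbar n \<alpha> jk k (takep n y) j)"
          by (rule sum.swap)
        also have "\<dots> = (\<Sum>k<m. (\<Sum>s<m. dropp n y s * defect k s (\<Phi> y)) * fbar n \<alpha> jk k (takep n y) j)"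
          unfolding sum_distrib_right
          by (intro sum.cong refl) (simp add: elim(2) sum_distrib_left sum_distrib_right)
        finally show ?thesis using True by simp
      qed
      with elim(1) j show "dmap (n + m) F euler y j = \<delta> j * F y j + (\<Sum>t\<in>T. b t (F y) * V t y j)"
        by simp
    qed
  qed
  from stable_liftable_correction[OF stable _ euler_analytic V b this]
  obtain \<zeta> where \<zeta>: "\<forall>t\<in>T. vf (p + m) (p + m) (\<zeta> t)"
    and lift: "liftable (n + m) (p + m) F (\<lambda>Y j. \<delta> j * Y j + (\<Sum>t\<in>T. b t Y * \<zeta> t Y j))"
    by (auto simp: T_def)
  define \<eta> where "\<eta> = (\<lambda>Y j. \<delta> j * Y j + (\<Sum>t\<in>T. b t Y * \<zeta> t Y j))"
  \<comment> \<open>The factor \<open>Y i\<close> kept in \<open>b\<close> makes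
    \<open>B k s\<close> vanish at the origin whatever the fields \<open>\<zeta>\<close>
    are.\<close>
  define B where "B k s Y = (\<Sum>i<p + m. Y i * \<zeta> (s, i) Y (p + k))" for k s and Y :: "nat \<Rightarrow> 'k"
  have "vf (p + m) (p + m) \<eta>"
    using \<zeta> by (auto simp: vf_def \<eta>_def T_def b_def
        intro!: analytic0_add analytic0_mult analytic0_sum analytic0_coordinate)
  \<comment> \<open>The field has characteristic zero, so distinct degrees stay distinct in
    it.\<close>
  moreover have "c k \<noteq> 0" if "k < m" for k
    using good[OF that] by (simp add: c_def)
  moreover have "analytic0 (p + m) (B k s)" if "k < m" "s < m" for k s
    using \<zeta> that by (auto simp: vf_def B_def[abs_def] T_def intro!: analytic0_sum analytic0_mult analytic0_coordinate)
  moreover have "B k s (\<lambda>_. 0) = 0" for k s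
    by (simp add: B_def)
  moreover have "\<eta> Y (p + k) = Y (p + k) * c k + (\<Sum>s<m. Y (p + s) * B k s Y)" for Y k
    unfolding \<eta>_def T_def
    by (subst sum.cartesian_product')
      (simp add: b_def B_def \<delta>_def sum_distrib_left mult_ac)
  \<comment> \<open>The units are the constant functions with value \<open>c k\<close>.\<close>
  ultimately show ?thesis
    using stable lift unfolding substantial_def germ_eq_iff \<eta>_def[symmetric]
    by (intro conjI exI[of _ \<eta>] exI[of _ "\<lambda>k _. c k"] exI[of _ B]) auto
qed

end

theorem mainTheorem5:
  fixes f :: "(nat \<Rightarrow> 'k::{real_normed_field,banach}) \<Rightarrow> (nat \<Rightarrow> 'k)"
    and n p m :: nat
    and \<alpha> :: "nat \<Rightarrow> nat \<Rightarrow> nat" and jk :: "nat \<Rightarrow> nat"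
    and q :: "nat \<Rightarrow> nat \<Rightarrow> (nat \<Rightarrow> 'k) \<Rightarrow> 'k"
  assumes f_analytic: "vf n p f"
    and f_zero: "\<forall>j<p. f (\<lambda>_. 0) j = 0"
    and f_finite: "Ke_finite n p f"
    and jk_range: "\<forall>k<m. jk k < p"
    and alpha_idx: "\<forall>k<m. \<alpha> k \<in> multi_idx n"
    and fbar_spans: "spans n p f m (fbar n \<alpha> jk)"
    and m_minimal: "\<forall>m' g. (\<forall>k<m'. vf n p (g k)) \<and> spans n p f m' g \<longrightarrow> m \<le> m'"
    and good: "wh_good_weights n p m f \<alpha> jk"
    and q_analytic: "\<forall>k<m. \<forall>s<m. analytic0 (p + m) (q k s)"
    and q_zero: "\<forall>k<m. \<forall>s<m. q k s (\<lambda>_. 0) = 0"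
    and F_stable: "stable (n + m) (p + m) (unf n p m f \<alpha> jk q)"
  shows "substantial n p m (unf n p m f \<alpha> jk q)"
proof -
  from good obtain w d where
    hom: "\<exists>r>0. \<forall>x. (\<forall>i<n. norm (x i) < r) \<longrightarrow> (\<forall>t::'k. norm t \<le> 1 \<longrightarrow>
        (\<forall>j<p. f (\<lambda>i. t ^ w i * x i) j = t ^ d j * f x j))" and
    weights: "\<And>k. k < m \<Longrightarrow> (\<Sum>i<n. w i * \<alpha> k i) \<noteq> d (jk k)"
    unfolding wh_good_weights_def by auto
  interpret weighted_unfolding f n p m \<alpha> jk q w d
    by unfold_locales (use assms hom in \<open>auto simp: eventually_germ0\<close>)
  show ?thesis
    by (rule stable_imp_substantial[OF F_stable]) (simp add: deg_def weights)
qed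

end
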